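(* Let $p \geq 2$ be an integer and let $X$ and $Y$ be totally ordered sets, each of cardinality at least $p$, such that there exists a $\mathrm{TP}_p$ kernel on $X \times Y$. Let $\mathscr{F}^{\mathrm{TP}}_{X,Y}(p)$ be the set of functions $F : (0,\infty) \to \mathbb{R}$ such that $F \circ K$ is $\mathrm{TP}_p$ for every $\mathrm{TP}_p$ kernel $K$ on $X \times Y$. Then, as sets of functions of $x \in (0,\infty)$: (1) if $p = 2$, $\mathscr{F}^{\mathrm{TP}}_{X,Y}(2) = \{ c x^\alpha : c > 0, \ \alpha > 0 \}$; (2) if $p = 3$, $\mathscr{F}^{\mathrm{TP}}_{X,Y}(3) = \{ c x^\alpha : c > 0, \ \alpha \geq 1 \}$; (3) if $p \geq 4$, $\mathscr{F}^{\mathrm{TP}}_{X,Y}(p) = \{ c x : c > 0 \}$.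
   Context: For totally ordered sets $X$ and $Y$ and an integer $p \geq 1$, a kernel $K : X \times Y \to \mathbb{R}$ is $\mathrm{TP}_p$ if $\det(K(x_i, y_j))_{i,j=1}^n > 0$ for all $1 \leq n \leq p$ and all $x_1 < \cdots < x_n$ in $X$ and $y_1 < \cdots < y_n$ in $Y$; in particular, such a kernel takes values in $(0,\infty)$. *)

theory Defs
  imports
    Complex_Main
    "HOL-Library.FuncSet"
    "Jordan_Normal_Form.Determinant"
begin

(* A totally ordered set is a carrier set in a type of class linorder; only the values of the
   kernel K on X \<times> Y matter. The indices run over 0, ..., n - 1. *)
definition TP_kernel :: "nat \<Rightarrow> 'a::linorder set \<Rightarrow> 'b::linorder set \<Rightarrow> ('a \<times> 'b \<Rightarrow> real) \<Rightarrow> bool" where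
  "TP_kernel p X Y K \<longleftrightarrow>
     (\<forall>n x y. 1 \<le> n \<and> n \<le> p
        \<and> x \<in> {..<n} \<rightarrow> X \<and> strict_mono_on {..<n} x
        \<and> y \<in> {..<n} \<rightarrow> Y \<and> strict_mono_on {..<n} y
        \<longrightarrow> det (mat n n (\<lambda>(i, j). K (x i, y j))) > 0)"

(* Functions (0, \<infinity>) \<rightarrow> \<real> are represented by extensional functions, so that equality of
   representatives is equality on (0, \<infinity>). A TP kernel of order p \<ge> 1 takes values in (0, \<infinity>)
   on X \<times> Y, so F \<circ> K is evaluated only there. *)
definition TP_preservers :: "nat \<Rightarrow> 'a::linorder set \<Rightarrow> 'b::linorder set \<Rightarrow> (real \<Rightarrow> real) set" where
  "TP_preservers p X Y =
     {F \<in> {0<..} \<rightarrow>\<^sub>E UNIV. \<forall>K. TP_kernel p X Y K \<longrightarrow> TP_kernel p X Y (F \<circ> K)}"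

end

theory Submission
  imports Defs "HOL-Real_Asymp.Real_Asymp"
begin

text \<open>
  A totally positive kernel on \<open>X \<times> Y\<close> provides strictly increasing maps \<open>U, V\<close> of \<open>X, Y\<close> into
  \<open>(0, \<infinity>)\<close>, namely quotients of two columns, respectively two rows. A rescaled
  \<open>exp (k U(x) V(y))\<close> then extends any prescribed positive \<open>2 \<times> 2\<close> matrix with positive
  determinant, so a preserver \<open>F\<close> satisfies \<open>F b F c < F a F d\<close> whenever \<open>b c < a d\<close>. After
  taking logarithms this forces \<open>F x = c x powr \<alpha>\<close> with \<open>\<alpha> > 0\<close>.

  The exponent is restricted by the kernels \<open>f (\<epsilon> U(x), \<eta> V(y))\<close> for polynomials
  \<open>f(u, v) = \<Sum>k. \<Phi>\<^sub>k(u) \<Psi>\<^sub>k(v)\<close>, which are totally positive by the Cauchy-Binet formula. As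
  \<open>\<epsilon>\<close> and then \<open>\<eta>\<close> tend to \<open>0\<close>, the sign of the \<open>n \<times> n\<close> minors of \<open>f powr \<alpha>\<close> is that
  of the determinant of its Taylor coefficients \<open>u\<^sup>i v\<^sup>j\<close>, \<open>i, j < n\<close>. For
  \<open>f = 1 + u v + \<delta> (u\<^sup>2 v\<^sup>2 + \<dots>)\<close> and \<open>n = 3\<close> it is negative if \<open>\<alpha> < 1\<close> and \<open>\<delta>\<close> is small; for
  \<open>f = 1 + (u + u\<^sup>2) v + u\<^sup>2 (v\<^sup>2 + t v\<^sup>3) + u\<^sup>3 v\<^sup>3 + \<dots>\<close> and \<open>n = 4\<close> it is negative if \<open>\<alpha> > 1\<close>
  and \<open>t\<close> is large.

  Conversely, a \<open>3 \<times> 3\<close> matrix can be rescaled to have first row and column \<open>1\<close>, and positivity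
  of its entrywise power for \<open>\<alpha> \<ge> 1\<close> becomes
  \<open>(b powr \<alpha> - 1) (c powr \<alpha> - 1) < (a powr \<alpha> - 1) (d powr \<alpha> - 1)\<close>. This follows from
  \<open>(b - 1) (c - 1) < (a - 1) (d - 1)\<close> because \<open>ln (x powr \<alpha> - 1)\<close> is convex in \<open>ln (x - 1)\<close>.
\<close>

section \<open>Determinants\<close>

abbreviation mdet :: "nat \<Rightarrow> (nat \<Rightarrow> nat \<Rightarrow> real) \<Rightarrow> real" where
  "mdet n f \<equiv> det (mat n n (\<lambda>(i, j). f i j))"

lemma mdet_cong:
  "(\<And>i j. i < n \<Longrightarrow> j < n \<Longrightarrow> f i j = g i j) \<Longrightarrow> mdet n f = mdet n g"
  by (intro arg_cong[where f = det] cong_mat) auto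

lemma mdet_leibniz:
  "mdet n f = (\<Sum>p | p permutes {0..<n}. signof p * (\<Prod>i=0..<n. f i (p i)))"
proof -
  have "mdet n f = (\<Sum>p | p permutes {0..<n}. signof p *
      (\<Prod>i=0..<n. mat n n (\<lambda>(i, j). f i j) $$ (i, p i)))"
    by (rule det_def') simp
  also have "\<dots> = (\<Sum>p | p permutes {0..<n}. signof p * (\<Prod>i=0..<n. f i (p i)))"
    by (intro sum.cong refl arg_cong2[where f = "(*)"] prod.cong)
       (auto dest: permutes_in_image)
  finally show ?thesis .
qed

lemma mdet_transpose: "mdet n (\<lambda>i j. f j i) = mdet n f"
proof -
  have "mat n n (\<lambda>(i, j). f j i) = transpose_mat (mat n n (\<lambda>(i, j). f i j))"
    by (intro eq_matI) auto
  then show ?thesis by (simp add: det_transpose[of _ n])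
qed

lemma mdet_scale:
  "mdet n (\<lambda>i j. r i * c j * f i j) = (\<Prod>i=0..<n. r i) * (\<Prod>j=0..<n. c j) * mdet n f"
proof -
  have "(\<Prod>i=0..<n. r i * c (p i) * f i (p i)) =
      (\<Prod>i=0..<n. r i) * (\<Prod>j=0..<n. c j) * (\<Prod>i=0..<n. f i (p i))"
    if "p permutes {0..<n}" for p
    using prod.permute[OF that, of c] by (simp add: prod.distrib o_def)
  then show ?thesis
    unfolding mdet_leibniz sum_distrib_left by (intro sum.cong refl) (simp add: algebra_simps)
qed

lemma mdet_permute_rows:
  assumes "p permutes {0..<n}"
  shows "mdet n (\<lambda>i j. f (p i) j) = signof p * mdet n f"
proof -
  have "mdet n (\<lambda>i j. f (p i) j) = det (mat n n (\<lambda>(i, j). mat n n (\<lambda>(i, j). f i j) $$ (p i, j)))"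
    using assms by (intro mdet_cong) (auto dest: permutes_in_image)
  also have "\<dots> = signof p * mdet n f"
    by (rule det_permute_rows[OF _ assms]) simp
  finally show ?thesis .
qed

lemma mdet_eq_rows:
  assumes "i < n" "j < n" "i \<noteq> j" "\<And>k. k < n \<Longrightarrow> f i k = f j k"
  shows "mdet n f = 0"
  by (rule det_identical_rows[of _ n i j]) (use assms in \<open>auto intro!: eq_vecI\<close>)

lemma mdet_expand_last_row:
  "mdet (Suc n) f = (\<Sum>j<Suc n. f n j * ((-1) ^ (n + j) *
     mdet n (\<lambda>i k. f i (if k < j then k else Suc k))))"
proof -
  have "mdet (Suc n) f = (\<Sum>j<Suc n. mat (Suc n) (Suc n) (\<lambda>(i, j). f i j) $$ (n, j) *
      cofactor (mat (Suc n) (Suc n) (\<lambda>(i, j). f i j)) n j)"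
    by (rule laplace_expansion_row) auto
  also have "\<dots> = (\<Sum>j<Suc n. f n j * ((-1) ^ (n + j) *
     mdet n (\<lambda>i k. f i (if k < j then k else Suc k))))"
    unfolding cofactor_def mat_delete_def
    by (intro sum.cong refl arg_cong2[where f = "(*)"] arg_cong[where f = det] eq_matI) auto
  finally show ?thesis .
qed

lemma mdet_0 [simp]: "mdet 0 f = 1"
  by (rule det_dim_zero) simp

lemma mdet_1: "mdet (Suc 0) f = f 0 0"
  by (simp add: mdet_expand_last_row)

lemma mdet_2: "mdet 2 f = f 0 0 * f 1 1 - f 0 1 * f 1 0"
  by (simp add: mdet_expand_last_row numeral_2_eq_2 algebra_simps)

lemma mdet_3: "mdet 3 f = f 0 0 * (f 1 1 * f 2 2 - f 1 2 * f 2 1)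
    - f 0 1 * (f 1 0 * f 2 2 - f 1 2 * f 2 0) + f 0 2 * (f 1 0 * f 2 1 - f 1 1 * f 2 0)"
  by (simp add: mdet_expand_last_row eval_nat_numeral algebra_simps)

text \<open>In the Leibniz expansion every product contains exactly one factor from row
  \<open>m\<close>, so the determinant is affine in that row.\<close>

lemma mdet_add_row:
  assumes "m < n"
  shows "mdet n (\<lambda>i j. f i j + (if i = m then s * g j else 0)) =
    mdet n f + s * mdet n (\<lambda>i j. if i = m then g j else f i j)"
proof -
  have *: "(\<Prod>i=0..<n. h i) = h m * (\<Prod>i\<in>{0..<n} - {m}. h i)" for h :: "nat \<Rightarrow> real"
    using assms by (intro prod.remove) auto
  have "(\<Prod>i=0..<n. f i (p i) + (if i = m then s * g (p i) else 0)) =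
      (\<Prod>i=0..<n. f i (p i)) + s * (\<Prod>i=0..<n. if i = m then g (p i) else f i (p i))" for p
  proof -
    define R where "R = (\<Prod>i\<in>{0..<n} - {m}. f i (p i))"
    have "(\<Prod>i\<in>{0..<n} - {m}. f i (p i) + (if i = m then s * g (p i) else 0)) = R"
      "(\<Prod>i\<in>{0..<n} - {m}. if i = m then g (p i) else f i (p i)) = R"
      unfolding R_def by (intro prod.cong; simp)+
    then show ?thesis
      by (simp only: * R_def[symmetric]) (simp add: algebra_simps)
  qed
  then show ?thesis
    unfolding mdet_leibniz sum_distrib_left sum.distrib[symmetric]
    by (intro sum.cong refl) (simp add: algebra_simps)
qed

section \<open>The Cauchy-Binet formula\<close>

lemma inj_on_factor_strict_mono:
  fixes f :: "nat \<Rightarrow> nat"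
  assumes "inj_on f {0..<n}"
  obtains s p where "strict_mono_on {0..<n} s" "p permutes {0..<n}"
    "\<And>i. i < n \<Longrightarrow> f i = s (p i)" "s ` {0..<n} = f ` {0..<n}"
proof -
  obtain s where s: "bij_betw s {..<card (f ` {0..<n})} (f ` {0..<n})"
      "strict_mono_on {..<card (f ` {0..<n})} s"
    using ex_bij_betw_strict_mono_card[of "f ` {0..<n}"] by blast
  have card: "{..<card (f ` {0..<n})} = {0..<n}"
    using assms by (simp add: card_image atLeast0LessThan)
  note s = s[unfolded card]
  \<comment> \<open>\<open>p i\<close> is the rank of \<open>f i\<close> in the image; outside the
    index range it is the identity, as a permutation of \<open>{0..<n}\<close> must be.\<close>
  define p where "p i = (if i < n then the_inv_into {0..<n} s (f i) else i)" for i
  have inj: "inj_on s {0..<n}" and im: "s ` {0..<n} = f ` {0..<n}"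
    using s by (auto simp: bij_betw_def)
  have p: "s (p i) = f i" "p i < n" if "i < n" for i
  proof -
    have "f i \<in> s ` {0..<n}" using that im by auto
    from f_the_inv_into_f[OF inj this] the_inv_into_into[OF inj this subset_refl]
    show "s (p i) = f i" "p i < n" using that by (auto simp: p_def)
  qed
  have "inj_on p {0..<n}"
  proof (rule inj_onI)
    fix i j assume "i \<in> {0..<n}" "j \<in> {0..<n}" "p i = p j"
    then have "f i = f j" using p(1)[of i] p(1)[of j] by simp
    then show "i = j" using inj_onD[OF assms, of i j] \<open>i \<in> _\<close> \<open>j \<in> _\<close> by simp
  qed
  moreover from this have "p ` {0..<n} = {0..<n}"
    by (intro endo_inj_surj) (use p(2) in auto)
  ultimately have "p permutes {0..<n}"
    by (intro bij_imp_permutes) (auto simp: bij_betw_def p_def)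
  from that[OF s(2) this p(1)[symmetric] im] show ?thesis .
qed

lemma strict_mono_on_image_unique:
  fixes s t :: "nat \<Rightarrow> nat"
  assumes "strict_mono_on {0..<n} s" "strict_mono_on {0..<n} t" "s ` {0..<n} = t ` {0..<n}"
    and "i < n"
  shows "s i = t i"
proof -
  have *: "sorted (map u [0..<n]) \<and> distinct (map u [0..<n])"
    if "strict_mono_on {0..<n} u" for u :: "nat \<Rightarrow> nat"
    using that strict_mono_on_imp_inj_on[OF that] strict_mono_on_leD[OF that]
    by (auto simp: distinct_map sorted_iff_nth_mono)
  have "map s [0..<n] = map t [0..<n]"
    using *[OF assms(1)] *[OF assms(2)] assms(3) by (intro sorted_distinct_set_unique) auto
  then show ?thesis using \<open>i < n\<close> by auto
qed

text \<open>An injective choice of indices is the increasing enumeration of its image, reordered by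
  a permutation. All index maps are extensional, so that the choice determines the pair. This is the
  reindexing behind the Cauchy-Binet formula.\<close>

lemma bij_betw_strict_mono_permutes:
  fixes n N :: nat
  shows "bij_betw (\<lambda>(s, p). restrict (s \<circ> p) {0..<n})
    ({s. s \<in> {0..<n} \<rightarrow>\<^sub>E {..<N} \<and> strict_mono_on {0..<n} s} \<times> {p. p permutes {0..<n}})
    {f \<in> {0..<n} \<rightarrow>\<^sub>E {..<N}. inj_on f {0..<n}}"
    (is "bij_betw ?h (?S \<times> ?P) ?I")
proof (rule bij_betw_imageI)
  have im: "restrict (s \<circ> p) {0..<n} ` {0..<n} = s ` {0..<n}" if "p permutes {0..<n}"
    for s p :: "nat \<Rightarrow> nat"
  proof -
    have "restrict (s \<circ> p) {0..<n} ` {0..<n} = s ` p ` {0..<n}" by (simp add: image_image)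
    then show ?thesis by (simp add: permutes_image[OF that])
  qed
  show "inj_on ?h (?S \<times> ?P)"
  proof (intro inj_onI, clarsimp)
    fix s p s' p' :: "nat \<Rightarrow> nat"
    assume s: "s \<in> {0..<n} \<rightarrow>\<^sub>E {..<N}" "strict_mono_on {0..<n} s"
      and s': "s' \<in> {0..<n} \<rightarrow>\<^sub>E {..<N}" "strict_mono_on {0..<n} s'"
      and p: "p permutes {0..<n}" "p' permutes {0..<n}"
      and eq: "restrict (s \<circ> p) {0..<n} = restrict (s' \<circ> p') {0..<n}"
    have "s ` {0..<n} = s' ` {0..<n}"
      using im[OF p(1), of s] im[OF p(2), of s'] eq by simp
    then have "s i = s' i" if "i < n" for i
      using strict_mono_on_image_unique[OF s(2) s'(2) _ that] by blast
    then have ss: "s = s'"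
      using s(1) s'(1) by (intro PiE_ext) auto
    have "p i = p' i" for i
    proof (cases "i < n")
      case True
      then have "s (p i) = s (p' i)" using fun_cong[OF eq, of i] ss by simp
      moreover have "p i < n" "p' i < n" using True p by (auto dest: permutes_in_image)
      ultimately show ?thesis
        using strict_mono_on_imp_inj_on[OF s(2)] by (auto dest: inj_onD)
    next
      case False
      then show ?thesis using p by (auto simp: permutes_def)
    qed
    then show "s = s' \<and> p = p'" using ss by auto
  qed
  show "?h ` (?S \<times> ?P) = ?I"
  proof (intro equalityI subsetI)
    fix f assume "f \<in> ?h ` (?S \<times> ?P)"
    then obtain s p where s: "s \<in> {0..<n} \<rightarrow>\<^sub>E {..<N}" "strict_mono_on {0..<n} s"
      and p: "p permutes {0..<n}" and f: "f = restrict (s \<circ> p) {0..<n}" by auto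
    have "p i < n" if "i < n" for i using that p by (auto dest: permutes_in_image)
    then have "f \<in> {0..<n} \<rightarrow>\<^sub>E {..<N}" using s(1) by (auto simp: f)
    moreover have "inj_on f {0..<n}"
      unfolding f inj_on_restrict_eq
      using permutes_inj_on[OF p] permutes_image[OF p] strict_mono_on_imp_inj_on[OF s(2)]
      by (intro comp_inj_on) auto
    ultimately show "f \<in> ?I" by simp
  next
    fix f assume f: "f \<in> ?I"
    then obtain s p where s: "strict_mono_on {0..<n} s" and p: "p permutes {0..<n}"
      and fs: "\<And>i. i < n \<Longrightarrow> f i = s (p i)" and im: "s ` {0..<n} = f ` {0..<n}"
      using inj_on_factor_strict_mono[of f n] by auto
    have "restrict s {0..<n} \<in> ?S"
    proof -
      have "s i < N" if "i < n" for i
      proof -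
        have "s i \<in> f ` {0..<n}" using im that by auto
        then show ?thesis using f by auto
      qed
      then show ?thesis using s by (auto simp: strict_mono_on_def)
    qed
    moreover have "f = restrict (restrict s {0..<n} \<circ> p) {0..<n}"
    proof
      show "f i = restrict (restrict s {0..<n} \<circ> p) {0..<n} i" for i
      proof (cases "i < n")
        case True
        then have "p i < n" using p by (auto dest: permutes_in_image)
        then show ?thesis using True fs[of i] by simp
      next
        case False
        then show ?thesis using f PiE_arb[of f "{0..<n}" "\<lambda>_. {..<N}" i] by simp
      qed
    qed
    ultimately show "f \<in> ?h ` (?S \<times> ?P)"
      using p by (intro image_eqI[where x = "(restrict s {0..<n}, p)"]) simp_all
  qed
qed

text \<open>Distributing products over sums gives one term per index map \<open>f\<close>. Maps that
  are not injective repeat a row of \<open>B\<close> and drop out; the others are grouped by their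
  image, and the signs from reordering the rows of \<open>B\<close> reassemble the minor of
  \<open>A\<close>.\<close>

lemma mdet_Cauchy_Binet:
  fixes A B :: "nat \<Rightarrow> nat \<Rightarrow> real"
  shows "mdet n (\<lambda>i j. \<Sum>k<N. A i k * B k j) =
    (\<Sum>s | s \<in> {0..<n} \<rightarrow>\<^sub>E {..<N} \<and> strict_mono_on {0..<n} s.
      mdet n (\<lambda>i j. A i (s j)) * mdet n (\<lambda>i j. B (s i) j))"
proof -
  let ?P = "{p. p permutes {0..<n}}"
  let ?F = "{0..<n} \<rightarrow>\<^sub>E {..<N}"
  let ?S = "{s. s \<in> ?F \<and> strict_mono_on {0..<n} s}"
  define T where "T f = (\<Prod>i=0..<n. A i (f i)) * mdet n (\<lambda>i j. B (f i) j)" for f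
  have finF: "finite ?F" by (intro finite_PiE) auto
  have "mdet n (\<lambda>i j. \<Sum>k<N. A i k * B k j) = (\<Sum>p\<in>?P. \<Sum>f\<in>?F. signof p *
      (\<Prod>i=0..<n. A i (f i) * B (f i) (p i)))"
    unfolding mdet_leibniz by (simp add: prod_sum_PiE sum_distrib_left)
  also have "\<dots> = (\<Sum>f\<in>?F. \<Sum>p\<in>?P. signof p * (\<Prod>i=0..<n. A i (f i) * B (f i) (p i)))"
    by (rule sum.swap)
  also have "\<dots> = (\<Sum>f\<in>?F. T f)"
    unfolding T_def mdet_leibniz sum_distrib_left
    by (intro sum.cong refl) (simp add: prod.distrib algebra_simps)
  also have "\<dots> = (\<Sum>f\<in>{f\<in>?F. inj_on f {0..<n}}. T f)"
  proof (rule sum.mono_neutral_right[OF finF])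
    show "\<forall>f\<in>?F - {f \<in> ?F. inj_on f {0..<n}}. T f = 0"
    proof
      fix f assume "f \<in> ?F - {f \<in> ?F. inj_on f {0..<n}}"
      then obtain i j where "i < n" "j < n" "i \<noteq> j" "f i = f j" by (auto simp: inj_on_def)
      then have "mdet n (\<lambda>i j. B (f i) j) = 0" by (intro mdet_eq_rows[of i _ j]) auto
      then show "T f = 0" by (simp add: T_def)
    qed
  qed auto
  also have "\<dots> = (\<Sum>(s, p)\<in>?S \<times> ?P. T (restrict (s \<circ> p) {0..<n}))"
    using sum.reindex_bij_betw[OF bij_betw_strict_mono_permutes[of n N], of T]
    by (simp add: case_prod_unfold)
  also have "\<dots> = (\<Sum>s\<in>?S. \<Sum>p\<in>?P. T (restrict (s \<circ> p) {0..<n}))"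
    by (simp add: sum.cartesian_product)
  also have "\<dots> = (\<Sum>s\<in>?S. mdet n (\<lambda>i j. A i (s j)) * mdet n (\<lambda>i j. B (s i) j))"
  proof (intro sum.cong refl)
    fix s assume "s \<in> ?S"
    have "T (restrict (s \<circ> p) {0..<n}) = signof p * (\<Prod>i=0..<n. A i (s (p i))) * mdet n (\<lambda>i j. B (s i) j)"
      if "p \<in> ?P" for p
    proof -
      have "mdet n (\<lambda>i j. B (restrict (s \<circ> p) {0..<n} i) j) = mdet n (\<lambda>i j. B (s (p i)) j)"
        by (intro mdet_cong) auto
      also have "\<dots> = signof p * mdet n (\<lambda>i j. B (s i) j)"
        using mdet_permute_rows[of p n "\<lambda>i. B (s i)"] that by simp
      finally show ?thesis by (simp add: T_def)
    qed
    then show "(\<Sum>p\<in>?P. T (restrict (s \<circ> p) {0..<n})) =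
        mdet n (\<lambda>i j. A i (s j)) * mdet n (\<lambda>i j. B (s i) j)"
      by (simp add: mdet_leibniz[of n "\<lambda>i j. A i (s j)"] sum_distrib_right)
  qed
  finally show ?thesis .
qed

section \<open>Total positivity of the exponential kernel\<close>

text \<open>Root counting by Rolle's theorem and induction: division by one exponential makes its
  term constant, and differentiation then removes that term at the cost of one zero.\<close>

lemma exp_sum_roots:
  fixes x l c :: "nat \<Rightarrow> real"
  assumes "strict_mono_on {..<n} x" "inj_on l {..<n}"
    and "\<And>i. i < n \<Longrightarrow> (\<Sum>j<n. c j * exp (x i * l j)) = 0"
    and "j < n"
  shows "c j = 0"
  using assms
proof (induction n arbitrary: x l c j)
  case (Suc n)
  define h where "h t = (\<Sum>j<Suc n. c j * exp (t * (l j - l n)))" for t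
  have hx: "h (x i) = 0" if "i < Suc n" for i
  proof -
    have "h (x i) = exp (- x i * l n) * (\<Sum>j<Suc n. c j * exp (x i * l j))"
      unfolding h_def sum_distrib_left
      by (intro sum.cong refl) (simp add: right_diff_distrib exp_diff exp_minus field_simps)
    then show ?thesis using Suc.prems(3)[OF that] by simp
  qed
  have "\<exists>z. x i < z \<and> z < x (Suc i) \<and>
      (\<Sum>j<n. c j * (l j - l n) * exp (z * (l j - l n))) = 0" if "i < n" for i
  proof -
    let ?h' = "\<lambda>t. \<Sum>j<Suc n. c j * (l j - l n) * exp (t * (l j - l n))"
    have deriv: "(h has_real_derivative ?h' t) (at t)" for t
      unfolding h_def by (auto intro!: derivative_eq_intros sum.cong simp: algebra_simps)
    have "\<exists>z. x i < z \<and> z < x (Suc i) \<and> (\<lambda>v. ?h' z * v) = (\<lambda>v. 0)"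
    proof (rule Rolle_deriv)
      show "x i < x (Suc i)" using Suc.prems(1) that by (auto simp: strict_mono_on_def)
      show "h (x i) = h (x (Suc i))" using hx that by simp
      show "continuous_on {x i..x (Suc i)} h"
        using deriv DERIV_isCont by (blast intro: continuous_at_imp_continuous_on)
      show "(h has_derivative (\<lambda>v. ?h' z * v)) (at z)" for z
        using deriv[of z] by (simp add: has_field_derivative_def)
    qed
    then obtain z where z: "x i < z" "z < x (Suc i)" "(\<lambda>v. ?h' z * v) = (\<lambda>v. 0)" by blast
    from fun_cong[OF z(3), of 1] z(1,2) show ?thesis by auto
  qed
  then obtain z where z: "\<And>i. i < n \<Longrightarrow> x i < z i \<and> z i < x (Suc i)"
    "\<And>i. i < n \<Longrightarrow> (\<Sum>j<n. c j * (l j - l n) * exp (z i * (l j - l n))) = 0" by metis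
  have mono: "strict_mono_on {..<n} z"
  proof (rule strict_mono_onI)
    fix i k assume ik: "i \<in> {..<n}" "k \<in> {..<n}" "i < k"
    have "z i < x (Suc i)" using z(1)[of i] ik by simp
    also have "x (Suc i) \<le> x k"
      using ik strict_mono_on_leD[OF Suc.prems(1), of "Suc i" k] by simp
    also have "x k < z k" using z(1)[of k] ik by simp
    finally show "z i < z k" .
  qed
  have inj: "inj_on (\<lambda>j. l j - l n) {..<n}"
    using Suc.prems(2) by (auto simp: inj_on_def)
  have c0: "c j = 0" if "j < n" for j
  proof -
    have "c j * (l j - l n) = 0"
      using Suc.IH[OF mono inj z(2) that] by simp
    moreover have "l j \<noteq> l n"
      using Suc.prems(2) that by (auto simp: inj_on_def)
    ultimately show ?thesis by simp
  qed
  \<comment> \<open>With all other coefficients zero, \<open>h\<close> is the constant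
    \<open>c n\<close>.\<close>
  have "c n = 0" using hx[of 0] c0 by (simp add: h_def)
  then show ?case using c0 Suc.prems(4) by (auto simp: less_Suc_eq)
qed simp

text \<open>Divided by the fastest growing exponential, every other term decays.\<close>

lemma exp_sum_top_coeff_tendsto:
  fixes l c :: "nat \<Rightarrow> real"
  assumes "\<And>j. j < n \<Longrightarrow> l j < l n"
  shows "((\<lambda>t. (\<Sum>j<Suc n. c j * exp (t * l j)) / exp (t * l n)) \<longlongrightarrow> c n) at_top"
proof -
  have "((\<lambda>t. \<Sum>j<n. c j * exp (t * (l j - l n))) \<longlongrightarrow> (\<Sum>j<n. c j * 0)) at_top"
  proof (intro tendsto_sum tendsto_mult tendsto_const)
    fix j assume "j \<in> {..<n}"
    then have "0 < l n - l j" using assms by simp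
    then have "LIM t at_top. (l n - l j) * t :> at_top"
      by (intro filterlim_tendsto_pos_mult_at_top[OF tendsto_const] filterlim_ident)
    then have "LIM t at_top. t * (l j - l n) :> at_bot"
      by (simp add: filterlim_uminus_at_bot algebra_simps)
    then show "((\<lambda>t. exp (t * (l j - l n))) \<longlongrightarrow> 0) at_top"
      by (rule filterlim_compose[OF exp_at_bot])
  qed
  from tendsto_add[OF this tendsto_const[of "c n"]]
  show ?thesis by (simp add: add_divide_distrib sum_divide_distrib exp_diff right_diff_distrib)
qed

text \<open>
  As a function of its last node, the determinant is an exponential sum whose positive top
  coefficient is a minor of the same kind; it vanishes at the other nodes and hence, by
  \<open>exp_sum_roots\<close>, nowhere beyond them.
\<close>

lemma mdet_exp_pos:
  fixes x l :: "nat \<Rightarrow> real"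
  assumes "strict_mono_on {..<n} x" "strict_mono_on {..<n} l"
  shows "mdet n (\<lambda>i j. exp (x i * l j)) > 0"
  using assms
proof (induction n arbitrary: x l)
  case (Suc n)
  define c where "c j = (-1) ^ (n + j) * mdet n (\<lambda>i k. exp (x i * l (if k < j then k else Suc k)))" for j
  define D where "D t = mdet (Suc n) (\<lambda>i j. exp ((if i < n then x i else t) * l j))" for t
  \<comment> \<open>Laplace expansion along the last row, the only one that contains
    \<open>t\<close>.\<close>
  have D: "D t = (\<Sum>j<Suc n. c j * exp (t * l j))" for t
    unfolding D_def mdet_expand_last_row c_def
    by (intro sum.cong refl) (simp add: cong: mdet_cong)
  have "mdet n (\<lambda>i k. exp (x i * l (if k < n then k else Suc k))) = mdet n (\<lambda>i k. exp (x i * l k))"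
    by (intro mdet_cong) simp
  then have cn: "c n > 0"
    using Suc.IH[of x l] Suc.prems by (simp add: c_def strict_mono_on_def)
  have D0: "D (x i) = 0" if "i < n" for i
    unfolding D_def using that by (intro mdet_eq_rows[of i _ n]) auto
  have Dn0: "D t \<noteq> 0" if t: "\<And>i. i < n \<Longrightarrow> x i < t" for t
  proof
    assume "D t = 0"
    have "c n = 0"
    proof (rule exp_sum_roots[where n = "Suc n" and l = l and x = "\<lambda>i. if i < n then x i else t"])
      show "strict_mono_on {..<Suc n} (\<lambda>i. if i < n then x i else t)"
        using Suc.prems(1) t by (auto simp: strict_mono_on_def)
      show "inj_on l {..<Suc n}" by (rule strict_mono_on_imp_inj_on[OF Suc.prems(2)])
      show "(\<Sum>j<Suc n. c j * exp ((if i < n then x i else t) * l j)) = 0" for i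
        using D0[of i] \<open>D t = 0\<close> by (simp add: D)
    qed simp
    with cn show False by simp
  qed
  have xn: "x i < x n" if "i < n" for i
    using Suc.prems(1) that by (simp add: strict_mono_on_def)
  have "((\<lambda>t. D t / exp (t * l n)) \<longlongrightarrow> c n) at_top"
    unfolding D using Suc.prems(2)
    by (intro exp_sum_top_coeff_tendsto) (auto simp: strict_mono_on_def)
  from order_tendstoD(1)[OF this cn]
  have "\<forall>\<^sub>F t in at_top. D t > 0" by (simp add: zero_less_divide_iff)
  then have "\<forall>\<^sub>F t in at_top. D t > 0 \<and> x n \<le> t"
    by (intro eventually_conj eventually_ge_at_top)
  then obtain t where t: "t \<ge> x n" "D t > 0"
    using eventually_happens'[OF trivial_limit_at_top_linorder] by blast
  have "D (x n) > 0"
  proof (rule ccontr)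
    assume "\<not> D (x n) > 0"
    then have "D (x n) \<le> 0" by simp
    moreover have "continuous_on {x n..t} D"
      unfolding D by (intro continuous_intros)
    ultimately obtain u where "x n \<le> u" "D u = 0"
      using IVT'[of D "x n" 0 t] t by auto
    then show False using Dn0[of u] xn by force
  qed
  moreover have "D (x n) = mdet (Suc n) (\<lambda>i j. exp (x i * l j))"
    unfolding D_def by (intro mdet_cong) (auto simp: less_Suc_eq)
  ultimately show ?case by simp
qed simp

section \<open>Totally positive kernels\<close>

lemma TP_kernelI:
  assumes "\<And>n x y. 1 \<le> n \<Longrightarrow> n \<le> p \<Longrightarrow> x \<in> {..<n} \<rightarrow> X \<Longrightarrow> strict_mono_on {..<n} x \<Longrightarrow>
    y \<in> {..<n} \<rightarrow> Y \<Longrightarrow> strict_mono_on {..<n} y \<Longrightarrow> mdet n (\<lambda>i j. K (x i, y j)) > 0"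
  shows "TP_kernel p X Y K"
  using assms by (simp add: TP_kernel_def)

lemma TP_kernelD:
  assumes "TP_kernel p X Y K" "1 \<le> n" "n \<le> p" "x \<in> {..<n} \<rightarrow> X" "strict_mono_on {..<n} x"
    "y \<in> {..<n} \<rightarrow> Y" "strict_mono_on {..<n} y"
  shows "mdet n (\<lambda>i j. K (x i, y j)) > 0"
  using assms by (simp add: TP_kernel_def)

lemma TP_kernel_cong:
  assumes "\<And>x y. x \<in> X \<Longrightarrow> y \<in> Y \<Longrightarrow> K (x, y) = L (x, y)"
  shows "TP_kernel p X Y K \<longleftrightarrow> TP_kernel p X Y L"
proof -
  have "mdet n (\<lambda>i j. K (x i, y j)) = mdet n (\<lambda>i j. L (x i, y j))"
    if "x \<in> {..<n} \<rightarrow> X" "y \<in> {..<n} \<rightarrow> Y" for n x y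
    using that by (intro mdet_cong assms) auto
  then show ?thesis by (force simp: TP_kernel_def)
qed

lemma TP_kernel_pos:
  assumes "TP_kernel p X Y K" "1 \<le> p" "x \<in> X" "y \<in> Y"
  shows "K (x, y) > 0"
proof -
  have "strict_mono_on {..<1::nat} (\<lambda>_. x)" "strict_mono_on {..<1::nat} (\<lambda>_. y)"
    by (auto simp: strict_mono_on_def)
  then show ?thesis
    using TP_kernelD[OF assms(1), of 1 "\<lambda>_. x" "\<lambda>_. y"] assms by (simp add: mdet_1)
qed

lemma TP_kernel_minor2:
  assumes "TP_kernel p X Y K" "2 \<le> p" "x1 \<in> X" "x2 \<in> X" "y1 \<in> Y" "y2 \<in> Y" "x1 < x2" "y1 < y2"
  shows "K (x1, y1) * K (x2, y2) > K (x1, y2) * K (x2, y1)"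
  using TP_kernelD[OF assms(1), of 2 "\<lambda>i. if i = 0 then x1 else x2" "\<lambda>i. if i = 0 then y1 else y2"] assms
  by (simp add: strict_mono_on_def mdet_2)

lemma TP_kernel_swap:
  assumes "TP_kernel p X Y K"
  shows "TP_kernel p Y X (\<lambda>(y, x). K (x, y))"
proof (rule TP_kernelI)
  fix n y x
  assume "1 \<le> n" "n \<le> p" "y \<in> {..<n} \<rightarrow> Y" "strict_mono_on {..<n} y"
    "x \<in> {..<n} \<rightarrow> X" "strict_mono_on {..<n} x"
  then have "mdet n (\<lambda>i j. K (x i, y j)) > 0" by (intro TP_kernelD[OF assms])
  then show "mdet n (\<lambda>i j. case (y i, x j) of (y, x) \<Rightarrow> K (x, y)) > 0"
    using mdet_transpose[of n "\<lambda>i j. K (x i, y j)"] by simp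
qed

lemma TP_kernel_scale:
  assumes "TP_kernel p X Y K" "\<And>x. x \<in> X \<Longrightarrow> g x > 0" "\<And>y. y \<in> Y \<Longrightarrow> h y > 0"
  shows "TP_kernel p X Y (\<lambda>(x, y). g x * h y * K (x, y))"
proof (rule TP_kernelI)
  fix n x y
  assume xy: "1 \<le> n" "n \<le> p" "x \<in> {..<n} \<rightarrow> X" "strict_mono_on {..<n} x"
    "y \<in> {..<n} \<rightarrow> Y" "strict_mono_on {..<n} y"
  have "(\<Prod>i=0..<n. g (x i)) > 0" "(\<Prod>j=0..<n. h (y j)) > 0"
    using xy by (auto intro!: prod_pos assms(2,3) simp: Pi_iff)
  then show "mdet n (\<lambda>i j. case (x i, y j) of (x, y) \<Rightarrow> g x * h y * K (x, y)) > 0"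
    using TP_kernelD[OF assms(1) xy] mdet_scale[of n "\<lambda>i. g (x i)" "\<lambda>j. h (y j)"] by simp
qed

lemma TP_kernel_exp:
  fixes U :: "'a::linorder \<Rightarrow> real" and V :: "'b::linorder \<Rightarrow> real"
  assumes "strict_mono_on X U" "strict_mono_on Y V"
  shows "TP_kernel p X Y (\<lambda>(x, y). exp (U x * V y))"
proof (rule TP_kernelI)
  fix n :: nat and x y
  assume "x \<in> {..<n} \<rightarrow> X" "strict_mono_on {..<n} x" "y \<in> {..<n} \<rightarrow> Y" "strict_mono_on {..<n} y"
  then have "strict_mono_on {..<n} (\<lambda>i. U (x i))" "strict_mono_on {..<n} (\<lambda>j. V (y j))"
    using assms by (auto simp: strict_mono_on_def Pi_iff)
  from mdet_exp_pos[OF this]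
  show "mdet n (\<lambda>i j. case (x i, y j) of (x, y) \<Rightarrow> exp (U x * V y)) > 0" by simp
qed

text \<open>Generalized Vandermonde determinants: in the coordinate \<open>ln (U x)\<close> a power
  is an exponential, with integers as the second family of nodes.\<close>

lemma TP_kernel_power:
  fixes U :: "'a::linorder \<Rightarrow> real"
  assumes "strict_mono_on X U" "\<And>x. x \<in> X \<Longrightarrow> U x > 0"
  shows "TP_kernel p X {..<N::nat} (\<lambda>(x, k). U x ^ k)"
proof -
  have "strict_mono_on X (\<lambda>x. ln (U x))"
    using assms by (auto simp: strict_mono_on_def)
  then have "TP_kernel p X {..<N} (\<lambda>(x, k). exp (ln (U x) * real k))"
    by (intro TP_kernel_exp) (auto simp: strict_mono_on_def)
  moreover have "exp (ln (U x) * real k) = U x ^ k" if "x \<in> X" for x k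
    using assms(2)[OF that] by (simp add: exp_of_nat2_mult)
  ultimately show ?thesis
    by (subst (asm) TP_kernel_cong) auto
qed

text \<open>By Cauchy-Binet each minor is a sum of products of two positive minors.\<close>

lemma TP_kernel_compose:
  fixes A :: "'a::linorder \<times> nat \<Rightarrow> real" and B :: "nat \<times> 'b::linorder \<Rightarrow> real"
  assumes A: "TP_kernel p X {..<p} A" and B: "TP_kernel p {..<p} Y B"
  shows "TP_kernel p X Y (\<lambda>(x, y). \<Sum>k<p. A (x, k) * B (k, y))"
proof (rule TP_kernelI)
  fix n x y
  assume n: "1 \<le> n" "n \<le> p" and x: "x \<in> {..<n} \<rightarrow> X" "strict_mono_on {..<n} x"
    and y: "y \<in> {..<n} \<rightarrow> Y" "strict_mono_on {..<n} y"
  let ?S = "{s. s \<in> {0..<n} \<rightarrow>\<^sub>E {..<p} \<and> strict_mono_on {0..<n} s}"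
  have "finite ?S" by (rule finite_subset[OF _ finite_PiE[of "{0..<n}" "\<lambda>_. {..<p}"]]) auto
  \<comment> \<open>Since \<open>n \<le> p\<close>, the first \<open>n\<close> indices form an
    admissible selection, so the sum is not empty.\<close>
  moreover have "restrict id {0..<n} \<in> ?S"
    using n by (auto simp: strict_mono_on_def)
  then have "?S \<noteq> {}" by blast
  moreover have "mdet n (\<lambda>i j. A (x i, s j)) * mdet n (\<lambda>i j. B (s i, y j)) > 0" if "s \<in> ?S" for s
    using that n x y
    by (intro mult_pos_pos TP_kernelD[OF A] TP_kernelD[OF B]) (auto simp: atLeast0LessThan PiE_def)
  ultimately have "(\<Sum>s\<in>?S. mdet n (\<lambda>i j. A (x i, s j)) * mdet n (\<lambda>i j. B (s i, y j))) > 0"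
    by (rule sum_pos)
  then show "mdet n (\<lambda>i j. case (x i, y j) of (x, y) \<Rightarrow> \<Sum>k<p. A (x, k) * B (k, y)) > 0"
    using mdet_Cauchy_Binet[where n = n and N = p and A = "\<lambda>i k. A (x i, k)" and B = "\<lambda>k j. B (k, y j)"] by simp
qed

text \<open>By linearity in row \<open>m\<close>, a minor using it gains \<open>s\<close> times the
  minor with row \<open>Suc m\<close> in its place. That one is zero if row \<open>Suc m\<close>
  already occurs; otherwise its rows are still in increasing order and it is positive.\<close>

lemma TP_kernel_add_row:
  fixes B :: "nat \<times> 'b::linorder \<Rightarrow> real"
  assumes B: "TP_kernel p {..<N} Y B" and m: "Suc m < N" and s: "s \<ge> 0"
  shows "TP_kernel p {..<N} Y (\<lambda>(k, y). B (k, y) + (if k = m then s * B (Suc k, y) else 0))"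
proof (rule TP_kernelI)
  fix n x y
  assume n: "1 \<le> n" "n \<le> p" and x: "x \<in> {..<n} \<rightarrow> {..<N}" "strict_mono_on {..<n} x"
    and y: "y \<in> {..<n} \<rightarrow> Y" "strict_mono_on {..<n} y"
  have pos: "mdet n (\<lambda>i j. B (x i, y j)) > 0" by (rule TP_kernelD[OF B n x y])
  show "mdet n (\<lambda>i j. case (x i, y j) of (k, y) \<Rightarrow> B (k, y) + (if k = m then s * B (Suc k, y) else 0)) > 0"
  proof (cases "m \<in> x ` {..<n}")
    case False
    then have "mdet n (\<lambda>i j. B (x i, y j) + (if x i = m then s * B (Suc (x i), y j) else 0)) =
        mdet n (\<lambda>i j. B (x i, y j))"
      by (intro mdet_cong) auto
    then show ?thesis using pos by simp
  next
    case True
    then obtain r where r: "r < n" "x r = m" by auto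
    have eq: "x i = m \<longleftrightarrow> i = r" if "i < n" for i
      using r that strict_mono_on_imp_inj_on[OF x(2)] by (auto dest: inj_onD)
    have "mdet n (\<lambda>i j. B (x i, y j) + (if x i = m then s * B (Suc (x i), y j) else 0)) =
        mdet n (\<lambda>i j. B (x i, y j) + (if i = r then s * B (Suc m, y j) else 0))"
      using eq by (intro mdet_cong) auto
    also have "\<dots> = mdet n (\<lambda>i j. B (x i, y j)) + s * mdet n (\<lambda>i j. if i = r then B (Suc m, y j) else B (x i, y j))"
      by (rule mdet_add_row[OF r(1)])
    finally have eq: "mdet n (\<lambda>i j. B (x i, y j) + (if x i = m then s * B (Suc (x i), y j) else 0)) =
        mdet n (\<lambda>i j. B (x i, y j)) + s * mdet n (\<lambda>i j. if i = r then B (Suc m, y j) else B (x i, y j))" .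
    have "mdet n (\<lambda>i j. if i = r then B (Suc m, y j) else B (x i, y j)) \<ge> 0"
    proof (cases "Suc m \<in> x ` {..<n}")
      case True
      then obtain q where q: "q < n" "x q = Suc m" by auto
      then have "q \<noteq> r" using r by auto
      then have "mdet n (\<lambda>i j. if i = r then B (Suc m, y j) else B (x i, y j)) = 0"
        using q r by (intro mdet_eq_rows[of q _ r]) auto
      then show ?thesis by simp
    next
      case False
      define x' where "x' i = (if i = r then Suc m else x i)" for i
      have "strict_mono_on {..<n} x'"
      proof (rule strict_mono_onI)
        fix i j assume ij: "i \<in> {..<n}" "j \<in> {..<n}" "i < j"
        have "x i < x j" using ij x(2) by (auto simp: strict_mono_on_def)
        moreover have "x j \<in> x ` {..<n}" using ij by simp
        with False have "x j \<noteq> Suc m" by metis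
        ultimately show "x' i < x' j" using r(2) by (auto simp: x'_def)
      qed
      moreover have "x' \<in> {..<n} \<rightarrow> {..<N}" using x(1) m by (auto simp: x'_def)
      ultimately have "mdet n (\<lambda>i j. B (x' i, y j)) > 0"
        using n y by (intro TP_kernelD[OF B])
      moreover have "mdet n (\<lambda>i j. B (x' i, y j)) = mdet n (\<lambda>i j. if i = r then B (Suc m, y j) else B (x i, y j))"
        by (intro mdet_cong) (auto simp: x'_def)
      ultimately show ?thesis by simp
    qed
    then have "s * mdet n (\<lambda>i j. if i = r then B (Suc m, y j) else B (x i, y j)) \<ge> 0"
      using s by simp
    then show ?thesis using pos eq by simp
  qed
qed

section \<open>Preservers are power functions\<close>

text \<open>\<open>card\<close> is 0 on infinite sets, hence the disjunction in the size
  hypothesis.\<close>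

lemma ex_strict_mono_nodes:
  fixes S :: "'a::linorder set"
  assumes "infinite S \<or> card S \<ge> n"
  obtains x :: "nat \<Rightarrow> 'a" where "x \<in> {..<n} \<rightarrow> S" "strict_mono_on {..<n} x"
proof -
  obtain T where T: "T \<subseteq> S" "finite T" "card T = n"
    using assms infinite_arbitrarily_large[of S n] obtain_subset_with_card_n[of n S] by metis
  define x where "x i = sorted_list_of_set T ! i" for i
  have len: "length (sorted_list_of_set T) = n" using T by simp
  have "x i \<in> S" if "i < n" for i
    using nth_mem[of i "sorted_list_of_set T"] that T len by (auto simp: x_def)
  moreover have "x i < x j" if "i < j" "j < n" for i j
    using sorted_wrt_nth_less[OF strict_sorted_list_of_set[of T] that(1)] that len by (simp add: x_def)
  ultimately show ?thesis by (intro that[of x]) (auto simp: strict_mono_on_def)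
qed

text \<open>Cross-multiplied, monotonicity of the quotient of two columns is the positivity of a 2
  by 2 minor.\<close>

lemma TP_kernel_embedding:
  fixes X :: "'a::linorder set" and Y :: "'b::linorder set"
  assumes K: "TP_kernel p X Y K" and p: "2 \<le> p" and Y: "infinite Y \<or> p \<le> card Y"
  obtains U :: "'a \<Rightarrow> real" where "strict_mono_on X U" "\<And>x. x \<in> X \<Longrightarrow> U x > 0"
proof -
  obtain y :: "nat \<Rightarrow> 'b" where y: "y \<in> {..<2} \<rightarrow> Y" "strict_mono_on {..<2} y"
    using ex_strict_mono_nodes[of Y 2] p Y by (metis order_trans)
  have yY: "y 0 \<in> Y" "y 1 \<in> Y" "y 0 < y 1" using y by (auto simp: strict_mono_on_def)
  have pos: "K (x, y i) > 0" if "x \<in> X" "i \<in> {0, 1}" for x i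
    using TP_kernel_pos[OF K _ that(1), of "y i"] yY p that by auto
  show ?thesis
  proof (rule that[of "\<lambda>x. K (x, y 1) / K (x, y 0)"])
    show "strict_mono_on X (\<lambda>x. K (x, y 1) / K (x, y 0))"
    proof (rule strict_mono_onI)
      fix r s assume rs: "r \<in> X" "s \<in> X" "r < s"
      show "K (r, y 1) / K (r, y 0) < K (s, y 1) / K (s, y 0)"
        using TP_kernel_minor2[OF K p rs(1,2) yY(1,2) rs(3) yY(3)] pos[OF rs(1)] pos[OF rs(2)]
        by (simp add: field_simps)
    qed
  qed (use pos in simp)
qed

lemma TP_preserversD:
  assumes "F \<in> TP_preservers p X Y" "TP_kernel p X Y K"
  shows "TP_kernel p X Y (F \<circ> K)"
  using assms by (auto simp: TP_preservers_def)

text \<open>A totally positive kernel is built whose values at two rows and two columns are exactly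
  \<open>a\<close>, \<open>b\<close>, \<open>c\<close>, \<open>d\<close>; the conclusions are then
  minors of its image under \<open>F\<close>.\<close>

lemma TP_preservers_2x2:
  fixes X :: "'a::linorder set" and Y :: "'b::linorder set"
    and U :: "'a \<Rightarrow> real" and V :: "'b \<Rightarrow> real"
  assumes F: "F \<in> TP_preservers p X Y" and p: "2 \<le> p"
    and X: "infinite X \<or> p \<le> card X" and Y: "infinite Y \<or> p \<le> card Y"
    and U: "strict_mono_on X U" and V: "strict_mono_on Y V"
    and pos: "0 < a" "0 < b" "0 < c" "0 < d" and minor: "b * c < a * d"
  shows "0 < F a" "F b * F c < F a * F d"
proof -
  obtain x :: "nat \<Rightarrow> 'a" where x: "x \<in> {..<2} \<rightarrow> X" "strict_mono_on {..<2} x"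
    using ex_strict_mono_nodes[of X 2] p X by (metis order_trans)
  obtain y :: "nat \<Rightarrow> 'b" where y: "y \<in> {..<2} \<rightarrow> Y" "strict_mono_on {..<2} y"
    using ex_strict_mono_nodes[of Y 2] p Y by (metis order_trans)
  have xX: "x 0 \<in> X" "x 1 \<in> X" "x 0 < x 1" using x by (auto simp: strict_mono_on_def)
  have yY: "y 0 \<in> Y" "y 1 \<in> Y" "y 0 < y 1" using y by (auto simp: strict_mono_on_def)
  define du where "du = U (x 1) - U (x 0)"
  define dv where "dv = V (y 1) - V (y 0)"
  have d: "du > 0" "dv > 0"
    using U V xX yY by (auto simp: du_def dv_def strict_mono_on_def)
  \<comment> \<open>\<open>E\<close> equals 1 at three of the four node pairs; \<open>k\<close> is
    chosen to make it \<open>a * d / (b * c)\<close> at the fourth. The strict inequality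
    \<open>minor\<close> makes \<open>k\<close> positive.\<close>
  define k where "k = ln (a * d / (b * c)) / (du * dv)"
  have k: "k > 0" using d pos minor by (simp add: k_def)
  \<comment> \<open>The row factors \<open>a\<close>, \<open>c\<close> and column factors
    \<open>1\<close>, \<open>b / a\<close> produce the four entries. They are positive on all of
    \<open>X\<close> and \<open>Y\<close>, so total positivity holds globally and not only at the
    nodes.\<close>
  define g where "g r = (if r = x 0 then a else c)" for r
  define h where "h s = (if s = y 0 then 1 else b / a)" for s
  define E where "E = (\<lambda>(r, s). exp (k * (U r - U (x 0)) * (V s - V (y 0))))"
  have "TP_kernel p X Y E"
    unfolding E_def using U V k
    by (intro TP_kernel_exp) (auto simp: strict_mono_on_def)
  then have K: "TP_kernel p X Y (\<lambda>(r, s). g r * h s * E (r, s))"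
    using pos by (intro TP_kernel_scale) (auto simp: g_def h_def)
  let ?K = "\<lambda>(r, s). g r * h s * E (r, s)"
  have "x 1 \<noteq> x 0" "y 1 \<noteq> y 0" using xX yY by auto
  then have v: "?K (x 0, y 0) = a" "?K (x 0, y 1) = b" "?K (x 1, y 0) = c"
    using pos by (simp_all add: g_def h_def E_def)
  have "E (x 1, y 1) = exp (ln (a * d / (b * c)))"
  proof -
    have "E (x 1, y 1) = exp (k * du * dv)" by (simp add: E_def du_def dv_def)
    also have "k * du * dv = ln (a * d / (b * c))" using d by (simp add: k_def)
    finally show ?thesis .
  qed
  also have "\<dots> = a * d / (b * c)" using pos by simp
  finally have v': "?K (x 1, y 1) = d"
    using pos \<open>x 1 \<noteq> x 0\<close> \<open>y 1 \<noteq> y 0\<close> by (simp add: g_def h_def field_simps)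
  have FK: "TP_kernel p X Y (F \<circ> ?K)" by (rule TP_preserversD[OF F K])
  show "0 < F a"
    using TP_kernel_pos[OF FK _ xX(1) yY(1)] p v by simp
  show "F b * F c < F a * F d"
    using TP_kernel_minor2[OF FK p xX(1,2) yY(1,2) xX(3) yY(3)] v v' by simp
qed

text \<open>The hypothesis yields strict monotonicity and a uniform modulus of continuity. These
  upgrade it to additivity, and a monotone additive function is linear.\<close>

lemma sum_order_preserving_affine:
  fixes G :: "real \<Rightarrow> real"
  assumes G: "\<And>a b c d. b + c < a + d \<Longrightarrow> G b + G c < G a + G d"
  obtains \<alpha> where "\<alpha> > 0" "\<And>t. G t = G 0 + \<alpha> * t"
proof -
  define g where "g t = G t - G 0" for t
  have g: "g b + g c < g a + g d" if "b + c < a + d" for a b c d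
    using G[OF that] by (simp add: g_def)
  have g0: "g 0 = 0" by (simp add: g_def)
  have mono: "g s < g t" if "s < t" for s t
    using g[of s s t t] that by simp
  define \<alpha> where "\<alpha> = g 1"
  have \<alpha>: "\<alpha> > 0" using mono[of 0 1] g0 by (simp add: \<alpha>_def)
  have multi: "real n * g h \<le> g (real n * k)" if "h < k" for h k n
  proof (induction n)
    case (Suc n)
    have "g (real n * k) + g h \<le> g (real (Suc n) * k) + g 0"
      using g[of "real n * k" h "real (Suc n) * k" 0] that by (simp add: algebra_simps)
    then show ?case using Suc g0 by (simp add: algebra_simps)
  qed (simp add: g0)
  have small: "g (s + h) - g s \<le> \<alpha> / real n" if "n > 0" "h < 1 / real n" for s h n
  proof -
    \<comment> \<open>The midpoint leaves a strict gap on both sides, one for \<open>g\<close> and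
      one for \<open>multi\<close>.\<close>
    define k where "k = (h + 1 / real n) / 2"
    have k: "h < k" "k < 1 / real n" using that by (auto simp: k_def field_simps)
    have "g (s + h) + g 0 < g s + g k" by (rule g) (use k in simp)
    moreover have "g k \<le> \<alpha> / real n"
      using multi[OF k(2), of n] that by (simp add: \<alpha>_def field_simps)
    ultimately show ?thesis using g0 by linarith
  qed
  have le0: "x \<le> 0" if "\<And>n. n > 0 \<Longrightarrow> real n * x \<le> \<alpha>" for x
  proof (rule ccontr)
    assume "\<not> x \<le> 0"
    then have x: "x > 0" by simp
    obtain n where n: "\<alpha> < real n * x" using ex_less_of_nat_mult[OF x, of \<alpha>] by auto
    then have "n > 0" using \<alpha> by (cases n) auto
    with that[of n] n show False by simp
  qed
  \<comment> \<open>The hypothesis says nothing when the two sums agree. Shifting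
    \<open>s + t\<close> by a small \<open>h\<close> restores strictness, and \<open>small\<close>
    bounds the resulting error by \<open>\<alpha> / n\<close>.\<close>
  have add: "g (s + t) = g s + g t" for s t
  proof -
    have "g (s + t) - g s - g t \<le> 0"
    proof (rule le0)
      fix n :: nat assume n: "n > 0"
      define h where "h = 1 / (2 * real n)"
      have h: "0 < h" "h < 1 / real n" using n by (auto simp: h_def field_simps)
      have "g (s + t - h) + g 0 < g s + g t" by (rule g) (use h in simp)
      moreover have "g (s + t) - g (s + t - h) \<le> \<alpha> / real n"
        using small[OF n h(2), of "s + t - h"] by simp
      ultimately have "g (s + t) - g s - g t \<le> \<alpha> / real n" using g0 by simp
      then show "real n * (g (s + t) - g s - g t) \<le> \<alpha>" using n by (simp add: field_simps)
    qed
    moreover have "g s + g t - g (s + t) \<le> 0"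
    proof (rule le0)
      fix n :: nat assume n: "n > 0"
      define h where "h = 1 / (2 * real n)"
      have h: "0 < h" "h < 1 / real n" using n by (auto simp: h_def field_simps)
      have "g s + g t < g (s + t + h) + g 0" by (rule g) (use h in simp)
      moreover have "g (s + t + h) - g (s + t) \<le> \<alpha> / real n"
        by (rule small[OF n h(2)])
      ultimately have "g s + g t - g (s + t) \<le> \<alpha> / real n" using g0 by simp
      then show "real n * (g s + g t - g (s + t)) \<le> \<alpha>" using n by (simp add: field_simps)
    qed
    ultimately show ?thesis by simp
  qed
  have mult: "g (real n * t) = real n * g t" for n t
    by (induction n) (simp_all add: g0 add distrib_right)
  have pos: "g t = \<alpha> * t" if "t > 0" for t
  proof -
    \<comment> \<open>Monotonicity traps \<open>g (n * t)\<close> between the values at the integers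
      \<open>m\<close> and \<open>m + 1\<close>, which additivity makes explicit.\<close>
    have bounds: "real n * (g t - \<alpha> * t) \<le> \<alpha> \<and> real n * (\<alpha> * t - g t) \<le> \<alpha>" for n :: nat
    proof -
      define m where "m = nat \<lfloor>real n * t\<rfloor>"
      have m: "real m \<le> real n * t" "real n * t < real m + 1"
        using that unfolding m_def by (auto simp: of_nat_nat)
      have gm: "g (real m) = real m * \<alpha>" for m :: nat
        using mult[of m 1] by (simp add: \<alpha>_def)
      have "g (real m) \<le> g (real n * t)"
        using mono[of "real m" "real n * t"] m(1) by (cases "real m = real n * t") auto
      then have "real m * \<alpha> \<le> real n * g t" by (simp add: gm mult)
      moreover have "real n * g t \<le> (real m + 1) * \<alpha>"
        using mono[OF m(2)] gm[of "Suc m"] by (simp add: mult add.commute)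
      moreover have "real m * \<alpha> \<le> real n * t * \<alpha>" "real n * t * \<alpha> \<le> (real m + 1) * \<alpha>"
        using m \<alpha> by (auto intro!: mult_right_mono)
      ultimately show ?thesis by (simp add: algebra_simps)
    qed
    have "g t - \<alpha> * t \<le> 0" "\<alpha> * t - g t \<le> 0" by (rule le0; use bounds in blast)+
    then show ?thesis by simp
  qed
  have g_lin: "g t = \<alpha> * t" for t
    using pos[of t] pos[of "- t"] add[of t "- t"] g0
    by (cases t "0 :: real" rule: linorder_cases) auto
  have "G t = G 0 + \<alpha> * t" for t using g_lin[of t] by (simp add: g_def)
  with \<alpha> show ?thesis by (rule that)
qed

text \<open>In logarithmic coordinates products become sums, and an affine function becomes a power
  function.\<close>

lemma product_order_preserving_power:
  fixes F :: "real \<Rightarrow> real"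
  assumes pos: "\<And>a. 0 < a \<Longrightarrow> 0 < F a"
    and F: "\<And>a b c d. 0 < a \<Longrightarrow> 0 < b \<Longrightarrow> 0 < c \<Longrightarrow> 0 < d \<Longrightarrow> b * c < a * d \<Longrightarrow> F b * F c < F a * F d"
  obtains c \<alpha> where "c > 0" "\<alpha> > 0" "\<And>x. 0 < x \<Longrightarrow> F x = c * x powr \<alpha>"
proof -
  define G where "G t = ln (F (exp t))" for t
  have "G b + G c < G a + G d" if "b + c < a + d" for a b c d
  proof -
    have "exp b * exp c < exp a * exp d" using that by (simp add: exp_add[symmetric])
    then have "F (exp b) * F (exp c) < F (exp a) * F (exp d)" by (intro F) auto
    moreover have P: "0 < F (exp t)" for t by (rule pos) simp
    ultimately have "ln (F (exp b) * F (exp c)) < ln (F (exp a) * F (exp d))"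
      by (subst ln_less_cancel_iff) (auto intro: mult_pos_pos)
    then show ?thesis by (simp only: G_def ln_mult_pos[OF P P])
  qed
  then obtain \<alpha> where \<alpha>: "\<alpha> > 0" "\<And>t. G t = G 0 + \<alpha> * t"
    using sum_order_preserving_affine by blast
  have "F x = F 1 * x powr \<alpha>" if "x > 0" for x
  proof -
    have "F x = exp (G (ln x))" using that pos by (simp add: G_def)
    also have "\<dots> = exp (G 0) * x powr \<alpha>"
      by (subst \<alpha>(2)) (use that in \<open>simp add: exp_add powr_def\<close>)
    also have "exp (G 0) = F 1" using pos by (simp add: G_def)
    finally show ?thesis .
  qed
  moreover have "F 1 > 0" by (rule pos) simp
  ultimately show ?thesis using that \<alpha>(1) by blast
qed

section \<open>Entrywise powers of order three\<close>

lemma Bernoulli_powr: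
  fixes x \<alpha> :: real
  assumes "1 \<le> x" "1 \<le> \<alpha>"
  shows "1 + \<alpha> * (x - 1) \<le> x powr \<alpha>"
proof -
  have "1 powr \<alpha> - \<alpha> * 1 \<le> x powr \<alpha> - \<alpha> * x"
  proof (rule DERIV_nonneg_imp_nondecreasing[OF assms(1)])
    fix u :: real assume u: "1 \<le> u" "u \<le> x"
    have "((\<lambda>u. u powr \<alpha> - \<alpha> * u) has_real_derivative \<alpha> * u powr (\<alpha> - 1) - \<alpha>) (at u)"
      using u by (auto intro!: derivative_eq_intros)
    moreover have "1 \<le> u powr (\<alpha> - 1)" using u assms by (intro ge_one_powr_ge_zero) auto
    then have "0 \<le> \<alpha> * u powr (\<alpha> - 1) - \<alpha>" using assms by simp
    ultimately show "\<exists>y. ((\<lambda>u. u powr \<alpha> - \<alpha> * u) has_real_derivative y) (at u) \<and> 0 \<le> y" by blast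
  qed
  then show ?thesis by (simp add: algebra_simps)
qed

text \<open>Up to the factor \<open>\<alpha>\<close> these are the derivatives of
  \<open>ln (x powr \<alpha> - 1)\<close> with respect to \<open>ln (x - 1)\<close>, so their growth
  is the convexity needed for order three. Each is 1 minus a quotient that decreases by Bernoulli's
  inequality.\<close>

lemma powr_elasticity_mono:
  fixes x y \<alpha> :: real
  assumes "1 < x" "x \<le> y" "1 \<le> \<alpha>"
  shows "(x - 1) * x powr (\<alpha> - 1) / (x powr \<alpha> - 1) \<le> (y - 1) * y powr (\<alpha> - 1) / (y powr \<alpha> - 1)"
proof -
  have gt1: "1 < u powr \<alpha>" if "1 < u" for u
    using that assms by simp
  have "(y powr (\<alpha> - 1) - 1) / (y powr \<alpha> - 1) \<le> (x powr (\<alpha> - 1) - 1) / (x powr \<alpha> - 1)"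
  proof (rule DERIV_nonpos_imp_nonincreasing[OF assms(2)])
    fix u :: real assume "x \<le> u" "u \<le> y"
    then have u: "1 < u" using assms by simp
    let ?D = "((\<alpha> - 1) * u powr (\<alpha> - 2) * (u powr \<alpha> - 1) - (u powr (\<alpha> - 1) - 1) * (\<alpha> * u powr (\<alpha> - 1)))
       / ((u powr \<alpha> - 1) * (u powr \<alpha> - 1))"
    have "((\<lambda>u. (u powr (\<alpha> - 1) - 1) / (u powr \<alpha> - 1)) has_real_derivative ?D) (at u)"
      using u gt1[OF u] by (auto intro!: derivative_eq_intros simp: diff_diff_eq)
    moreover have "?D \<le> 0"
    proof (rule divide_nonpos_nonneg)
      have e: "u powr (\<alpha> - 1) = u powr (\<alpha> - 2) * u" "u powr \<alpha> = u powr (\<alpha> - 2) * u * u"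
        using u by (simp_all add: powr_diff power2_eq_square)
      have "(\<alpha> - 1) * u powr (\<alpha> - 2) * (u powr \<alpha> - 1) - (u powr (\<alpha> - 1) - 1) * (\<alpha> * u powr (\<alpha> - 1))
        = u powr (\<alpha> - 2) * (1 + \<alpha> * (u - 1) - u powr \<alpha>)"
        unfolding e by (simp add: algebra_simps)
      also have "\<dots> \<le> 0"
        using Bernoulli_powr[of u \<alpha>] u assms by (intro mult_nonneg_nonpos) auto
      finally show "(\<alpha> - 1) * u powr (\<alpha> - 2) * (u powr \<alpha> - 1) - (u powr (\<alpha> - 1) - 1) * (\<alpha> * u powr (\<alpha> - 1)) \<le> 0" .
    qed simp
    ultimately show "\<exists>z. ((\<lambda>u. (u powr (\<alpha> - 1) - 1) / (u powr \<alpha> - 1)) has_real_derivative z) (at u) \<and> z \<le> 0"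
      by blast
  qed
  moreover have "(u - 1) * u powr (\<alpha> - 1) / (u powr \<alpha> - 1) = 1 - (u powr (\<alpha> - 1) - 1) / (u powr \<alpha> - 1)"
    if "1 < u" for u
  proof -
    have "u powr \<alpha> = u powr (\<alpha> - 1) * u" using that by (simp add: powr_diff)
    then show ?thesis using gt1[OF that] by (simp add: field_simps)
  qed
  ultimately show ?thesis using assms by simp
qed

text \<open>By convexity of \<open>ln (q x)\<close> in \<open>ln x\<close>, the increment of
  \<open>ln q\<close> over a step \<open>ln s\<close> can only grow as the base point moves from
  \<open>A\<close> to \<open>A * t\<close>.\<close>

lemma powr_minus_one_log_supermodular:
  fixes A s t \<alpha> :: real
  assumes "0 < A" "1 \<le> s" "1 \<le> t" "1 \<le> \<alpha>"
  shows "((1 + A * s) powr \<alpha> - 1) * ((1 + A * t) powr \<alpha> - 1)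
    \<le> ((1 + A) powr \<alpha> - 1) * ((1 + A * t * s) powr \<alpha> - 1)"
proof -
  define q where "q x = (1 + x) powr \<alpha> - 1" for x :: real
  have q: "q x > 0" if "x > 0" for x using that assms by (simp add: q_def)
  have dq: "(q has_real_derivative \<alpha> * (1 + x) powr (\<alpha> - 1)) (at x)" if "x > 0" for x
    unfolding q_def using that by (auto intro!: derivative_eq_intros)
  have "ln (q (A * s)) - ln (q A) \<le> ln (q (A * t * s)) - ln (q (A * t))"
  proof (rule DERIV_nonneg_imp_nondecreasing[where f = "\<lambda>x. ln (q (x * s)) - ln (q x)"])
    show "A \<le> A * t" using assms by simp
    fix x assume "A \<le> x" "x \<le> A * t"
    then have x: "x > 0" using assms by simp
    then have xs: "x * s > 0" "x \<le> x * s" using assms by auto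
    let ?D = "s * (\<alpha> * (1 + x * s) powr (\<alpha> - 1)) / q (x * s) - \<alpha> * (1 + x) powr (\<alpha> - 1) / q x"
    have "((\<lambda>x. q (x * s)) has_real_derivative \<alpha> * (1 + x * s) powr (\<alpha> - 1) * s) (at x)"
      by (rule DERIV_chain2[where f = q and g = "\<lambda>x. x * s", OF dq[OF xs(1)]]) (auto intro!: derivative_eq_intros)
    then have "((\<lambda>x. ln (q (x * s)) - ln (q x)) has_real_derivative ?D) (at x)"
      using q[OF x] q[OF xs(1)] dq[OF x] by (auto intro!: derivative_eq_intros simp: field_simps)
    moreover have "?D = \<alpha> / x * (x * s * (1 + x * s) powr (\<alpha> - 1) / q (x * s) - x * (1 + x) powr (\<alpha> - 1) / q x)"
      using x q[OF x] q[OF xs(1)] by (simp add: field_simps)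
    moreover have "x * (1 + x) powr (\<alpha> - 1) / q x \<le> x * s * (1 + x * s) powr (\<alpha> - 1) / q (x * s)"
      using powr_elasticity_mono[of "1 + x" "1 + x * s" \<alpha>] x xs assms by (simp add: q_def)
    ultimately show "\<exists>y. ((\<lambda>x. ln (q (x * s)) - ln (q x)) has_real_derivative y) (at x) \<and> 0 \<le> y"
      using x assms by (intro exI[of _ ?D]) simp
  qed
  moreover have P: "0 < q A" "0 < q (A * s)" "0 < q (A * t)" "0 < q (A * t * s)"
    using assms by (auto intro!: q mult_pos_pos)
  ultimately have "ln (q (A * s) * q (A * t)) \<le> ln (q A * q (A * t * s))"
    by (simp add: ln_mult_pos)
  then have "q (A * s) * q (A * t) \<le> q A * q (A * t * s)"
    using P by (simp add: ln_le_cancel_iff mult_pos_pos)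
  then show ?thesis by (simp add: q_def)
qed

text \<open>With \<open>b = 1 + A * s\<close> and \<open>c = 1 + A * t\<close>, the value
  \<open>1 + A * t * s\<close> in place of \<open>d\<close> would make \<open>minor\<close> an
  equality. So \<open>d\<close> exceeds it, and strictness comes from the monotonicity of the
  power.\<close>

lemma powr_minus_one_minor:
  fixes a b c d \<alpha> :: real
  assumes "1 < a" "a < b" "a < c" "1 \<le> \<alpha>" and minor: "(b - 1) * (c - 1) < (a - 1) * (d - 1)"
  shows "(b powr \<alpha> - 1) * (c powr \<alpha> - 1) < (a powr \<alpha> - 1) * (d powr \<alpha> - 1)"
proof -
  define A where "A = a - 1"
  define s where "s = (b - 1) / A"
  define t where "t = (c - 1) / A"
  have A: "0 < A" using assms by (simp add: A_def)
  have st: "1 \<le> s" "1 \<le> t" using assms A by (auto simp: s_def t_def A_def field_simps)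
  have e: "1 + A = a" "1 + A * s = b" "1 + A * t = c"
    using A by (auto simp: A_def[symmetric] s_def t_def) (simp add: A_def)
  have "A * (A * t * s) = (b - 1) * (c - 1)" using A by (simp add: s_def t_def)
  also have "\<dots> < A * (d - 1)" using minor by (simp add: A_def)
  finally have d: "1 + A * t * s < d" using A by simp
  have "(b powr \<alpha> - 1) * (c powr \<alpha> - 1) \<le> (a powr \<alpha> - 1) * ((1 + A * t * s) powr \<alpha> - 1)"
    using powr_minus_one_log_supermodular[OF A st assms(4)] by (simp add: e)
  also have "\<dots> < (a powr \<alpha> - 1) * (d powr \<alpha> - 1)"
  proof -
    have "(1 + A * t * s) powr \<alpha> < d powr \<alpha>"
      using d A st assms by (intro powr_less_mono2) auto
    moreover have "1 < a powr \<alpha>" using assms by simp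
    ultimately show ?thesis by simp
  qed
  finally show ?thesis .
qed

text \<open>Subtracting the first row from the others leaves a 2 by 2 determinant.\<close>

lemma mdet_3_unit_border:
  assumes "\<And>j. j < 3 \<Longrightarrow> f 0 j = 1" "\<And>i. i < 3 \<Longrightarrow> f i 0 = 1"
  shows "mdet 3 f = (f 1 1 - 1) * (f 2 2 - 1) - (f 1 2 - 1) * (f 2 1 - 1)"
  using assms by (simp add: mdet_3 algebra_simps)

text \<open>Positive row and column factors pass through the power and do not affect the sign, so
  the border may be normalized to 1. The three assumed minors then say \<open>1 < N 1 1\<close>,
  \<open>N 1 1 < N 1 2\<close> and \<open>N 1 1 < N 2 1\<close>.\<close>

lemma mdet_3_powr_pos:
  fixes M :: "nat \<Rightarrow> nat \<Rightarrow> real"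
  assumes pos: "\<And>i j. i < 3 \<Longrightarrow> j < 3 \<Longrightarrow> M i j > 0" and det: "mdet 3 M > 0" and \<alpha>: "1 \<le> \<alpha>"
    and minor: "M 0 1 * M 1 0 < M 0 0 * M 1 1" "M 0 2 * M 1 1 < M 0 1 * M 1 2"
      "M 1 1 * M 2 0 < M 1 0 * M 2 1"
  shows "mdet 3 (\<lambda>i j. M i j powr \<alpha>) > 0"
proof -
  define r where "r i = M i 0" for i
  define c where "c j = M 0 j / M 0 0" for j
  define N where "N i j = M i j / (r i * c j)" for i j
  have rc: "r i > 0" "c i > 0" if "i < 3" for i using pos that by (auto simp: r_def c_def)
  have MN: "M i j = r i * c j * N i j" if "i < 3" "j < 3" for i j
    using rc[OF that(1)] rc[OF that(2)] by (simp add: N_def)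
  have Npos: "N i j > 0" if "i < 3" "j < 3" for i j
    using rc[OF that(1)] rc[OF that(2)] pos[OF that] by (simp add: N_def)
  have border: "N 0 j = 1" "N j 0 = 1" if "j < 3" for j
    using pos[of 0 j] pos[of j 0] pos[of 0 0] that by (auto simp: N_def r_def c_def)
  have "mdet 3 M = mdet 3 (\<lambda>i j. r i * c j * N i j)" by (intro mdet_cong MN)
  also have "\<dots> = (\<Prod>i=0..<3. r i) * (\<Prod>j=0..<3. c j) * mdet 3 N" by (rule mdet_scale)
  finally have "(\<Prod>i=0..<3. r i) * (\<Prod>j=0..<3. c j) * mdet 3 N > 0" using det by simp
  moreover have "(\<Prod>i=0..<3. r i) > 0" "(\<Prod>j=0..<3. c j) > 0"
    using rc by (auto intro!: prod_pos)
  ultimately have "mdet 3 N > 0" by (meson mult_pos_pos zero_less_mult_pos)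
  then have "(N 1 2 - 1) * (N 2 1 - 1) < (N 1 1 - 1) * (N 2 2 - 1)"
    using mdet_3_unit_border[of N] border by simp
  moreover have "1 < N 1 1" "N 1 1 < N 1 2" "N 1 1 < N 2 1"
    using minor pos[of 0 0] pos[of 0 1] pos[of 0 2] pos[of 1 0] pos[of 1 1] pos[of 2 0]
    by (simp_all add: N_def r_def c_def field_simps)
  ultimately have "(N 1 2 powr \<alpha> - 1) * (N 2 1 powr \<alpha> - 1) < (N 1 1 powr \<alpha> - 1) * (N 2 2 powr \<alpha> - 1)"
    using \<alpha> by (intro powr_minus_one_minor)
  then have "mdet 3 (\<lambda>i j. N i j powr \<alpha>) > 0"
    using mdet_3_unit_border[of "\<lambda>i j. N i j powr \<alpha>"] border by simp
  moreover have "(\<Prod>i=0..<3. r i powr \<alpha>) > 0" "(\<Prod>j=0..<3. c j powr \<alpha>) > 0"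
    using rc by (force intro!: prod_pos)+
  moreover have "mdet 3 (\<lambda>i j. M i j powr \<alpha>) = mdet 3 (\<lambda>i j. r i powr \<alpha> * c j powr \<alpha> * N i j powr \<alpha>)"
    using rc Npos by (intro mdet_cong) (simp add: MN powr_mult less_imp_le)
  ultimately show ?thesis by (simp add: mdet_scale)
qed

lemma TP_kernel_powr_2:
  assumes K: "TP_kernel 2 X Y K" and \<alpha>: "0 < \<alpha>"
  shows "TP_kernel 2 X Y (\<lambda>z. K z powr \<alpha>)"
proof (rule TP_kernelI)
  fix n :: nat and x y
  assume n: "1 \<le> n" "n \<le> 2" and x: "x \<in> {..<n} \<rightarrow> X" "strict_mono_on {..<n} x"
    and y: "y \<in> {..<n} \<rightarrow> Y" "strict_mono_on {..<n} y"
  have pos: "K (x i, y j) > 0" if "i < n" "j < n" for i j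
    using TP_kernel_pos[OF K _ funcset_mem[OF x(1)] funcset_mem[OF y(1)]] that by simp
  have det: "mdet n (\<lambda>i j. K (x i, y j)) > 0" by (rule TP_kernelD[OF K n x y])
  consider "n = 1" | "n = 2" using n by linarith
  then show "mdet n (\<lambda>i j. K (x i, y j) powr \<alpha>) > 0"
  proof cases
    case 1
    then show ?thesis using pos[of 0 0] by (simp add: mdet_1)
  next
    case 2
    have "(K (x 0, y 1) * K (x 1, y 0)) powr \<alpha> < (K (x 0, y 0) * K (x 1, y 1)) powr \<alpha>"
      using det pos 2 \<alpha> by (intro powr_less_mono2) (auto simp: mdet_2 less_imp_le)
    then show ?thesis using pos 2 by (simp add: mdet_2 powr_mult less_imp_le)
  qed
qed

lemma TP_kernel_le:
  assumes "TP_kernel p X Y K" "q \<le> p"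
  shows "TP_kernel q X Y K"
  using assms by (auto simp: TP_kernel_def)

lemma TP_kernel_powr_3:
  assumes K: "TP_kernel 3 X Y K" and \<alpha>: "1 \<le> \<alpha>"
  shows "TP_kernel 3 X Y (\<lambda>z. K z powr \<alpha>)"
proof (rule TP_kernelI)
  fix n :: nat and x y
  assume n: "1 \<le> n" "n \<le> 3" and x: "x \<in> {..<n} \<rightarrow> X" "strict_mono_on {..<n} x"
    and y: "y \<in> {..<n} \<rightarrow> Y" "strict_mono_on {..<n} y"
  show "mdet n (\<lambda>i j. K (x i, y j) powr \<alpha>) > 0"
  proof (cases "n \<le> 2")
    case True
    have "TP_kernel 2 X Y (\<lambda>z. K z powr \<alpha>)"
      using TP_kernel_powr_2[OF TP_kernel_le[OF K]] \<alpha> by simp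
    from TP_kernelD[OF this n(1) True x y] show ?thesis .
  next
    case False
    then have n3: "n = 3" using n by simp
    have pos: "K (x i, y j) > 0" if "i < 3" "j < 3" for i j
      using TP_kernel_pos[OF K _ funcset_mem[OF x(1)] funcset_mem[OF y(1)]] that n3 by simp
    have minor: "K (x i, y l) * K (x k, y j) < K (x i, y j) * K (x k, y l)"
      if "i < k" "j < l" "k < 3" "l < 3" for i j k l
      using x y n3 that by (intro TP_kernel_minor2[OF K]) (auto simp: strict_mono_on_def Pi_iff)
    show ?thesis
      unfolding n3
    proof (rule mdet_3_powr_pos[OF pos _ \<alpha>])
      show "mdet 3 (\<lambda>i j. K (x i, y j)) > 0" using TP_kernelD[OF K n x y] n3 by simp
    qed (use minor[of 0 1 0 1] minor[of 0 1 1 2] minor[of 1 2 0 1] in auto)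
  qed
qed

section \<open>Determinants of Taylor coefficients\<close>

lemma mdet_mult: "mdet n (\<lambda>i j. \<Sum>k<n. A i k * B k j) = mdet n A * mdet n B"
proof -
  have "mat n n (\<lambda>(i, j). \<Sum>k<n. A i k * B k j) = mat n n (\<lambda>(i, j). A i j) * mat n n (\<lambda>(i, j). B i j)"
    by (intro eq_matI) (auto simp: scalar_prod_def atLeast0LessThan)
  then show ?thesis by (simp add: det_mult[of _ n])
qed

lemma tendsto_mdet:
  assumes "\<And>i j. i < n \<Longrightarrow> j < n \<Longrightarrow> ((\<lambda>x. f x i j) \<longlongrightarrow> l i j) F"
  shows "((\<lambda>x. mdet n (f x)) \<longlongrightarrow> mdet n l) F"
  unfolding mdet_leibniz
proof (intro tendsto_sum tendsto_mult tendsto_const tendsto_prod)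
  fix p i assume "p \<in> {p. p permutes {0..<n}}" "i \<in> {0..<n}"
  then show "((\<lambda>x. f x i (p i)) \<longlongrightarrow> l i (p i)) F"
    by (intro assms) (auto dest: permutes_in_image)
qed

text \<open>\<open>W\<close> is the adjugate divided by the determinant. Its positive determinant
  ensures that multiplication by \<open>W\<close> preserves signs.\<close>

lemma vandermonde_left_inverse:
  fixes \<xi> :: "nat \<Rightarrow> real"
  assumes "strict_mono_on {..<n} \<xi>" "\<And>i. i < n \<Longrightarrow> \<xi> i > 0"
  obtains W where "mdet n W > 0"
    "\<And>k l. k < n \<Longrightarrow> l < n \<Longrightarrow> (\<Sum>i<n. W k i * \<xi> i ^ l) = (if k = l then 1 else 0)"
proof -
  define V where "V = mat n n (\<lambda>(i, k). \<xi> i ^ k)"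
  have "TP_kernel n {0<..} {..<n} (\<lambda>(x::real, k). x ^ k)"
    by (rule TP_kernel_power) (auto simp: strict_mono_on_def)
  from TP_kernelD[OF this _ order_refl, of \<xi> id]
  have D: "det V > 0"
    using assms by (cases "n = 0") (auto simp: V_def strict_mono_on_def)
  have V: "V \<in> carrier_mat n n" by (simp add: V_def)
  define W where "W k i = adj_mat V $$ (k, i) / det V" for k i
  have W: "(\<Sum>i<n. W k i * \<xi> i ^ l) = (if k = l then 1 else 0)" if "k < n" "l < n" for k l
  proof -
    have "(adj_mat V * V) $$ (k, l) = (\<Sum>i<n. adj_mat V $$ (k, i) * \<xi> i ^ l)"
      using that adj_mat(1)[OF V] by (auto simp: scalar_prod_def V_def atLeast0LessThan)
    also have "(adj_mat V * V) $$ (k, l) = det V * (if k = l then 1 else 0)"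
      using that adj_mat(3)[OF V] by simp
    finally show ?thesis
      using D by (simp add: W_def sum_divide_distrib[symmetric] split: if_splits)
  qed
  have "mdet n W * mdet n (\<lambda>i k. \<xi> i ^ k) = mdet n (\<lambda>k l. if k = l then 1 else 0)"
    unfolding mdet_mult[symmetric] by (intro mdet_cong W)
  also have "mat n n (\<lambda>(k, l). if k = l then 1 else (0::real)) = 1\<^sub>m n"
    by (intro eq_matI) auto
  finally have "mdet n W * det V = 1" by (simp add: V_def)
  then have "mdet n W > 0" using D zero_less_mult_pos2[of "mdet n W" "det V"] by simp
  then show ?thesis using W by (rule that)
qed

lemma filterlim_mult_pos_at_right_0:
  fixes x :: real
  assumes "x > 0"
  shows "filterlim (\<lambda>\<epsilon>. \<epsilon> * x) (at_right 0) (at_right 0)"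
  unfolding filterlim_at
proof
  show "\<forall>\<^sub>F \<epsilon> in at_right 0. \<epsilon> * x \<in> {0<..} \<and> \<epsilon> * x \<noteq> 0"
    by (rule eventually_mono[OF eventually_at_right_less]) (use assms in auto)
qed (auto intro!: tendsto_eq_intros)

text \<open>
  Multiplication by the inverse \<open>W\<close> of the Vandermonde matrix of \<open>\<xi>\<close>, followed by scaling row
  \<open>k\<close> with \<open>\<epsilon>\<close> to the power \<open>-k\<close>, turns the matrix \<open>h\<^sub>j(\<epsilon> \<xi>\<^sub>i)\<close> into one that converges to \<open>c\<close>.
\<close>

lemma mdet_Peano_coeffs_nonneg:
  fixes \<xi> :: "nat \<Rightarrow> real" and h :: "nat \<Rightarrow> real \<Rightarrow> real" and c :: "nat \<Rightarrow> nat \<Rightarrow> real"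
  assumes \<xi>: "strict_mono_on {..<n} \<xi>" "\<And>i. i < n \<Longrightarrow> \<xi> i > 0"
    and lim: "\<And>j. j < n \<Longrightarrow>
      ((\<lambda>s. (h j s - (\<Sum>k<n. c k j * s ^ k)) / s ^ (n - 1)) \<longlongrightarrow> 0) (at_right 0)"
    and nonneg: "\<And>\<epsilon>. \<epsilon> > 0 \<Longrightarrow> mdet n (\<lambda>i j. h j (\<epsilon> * \<xi> i)) \<ge> 0"
  shows "mdet n c \<ge> 0"
proof -
  obtain W where W: "mdet n W > 0"
    "\<And>k l. k < n \<Longrightarrow> l < n \<Longrightarrow> (\<Sum>i<n. W k i * \<xi> i ^ l) = (if k = l then 1 else 0)"
    using vandermonde_left_inverse[OF \<xi>] by blast
  define R where "R j s = h j s - (\<Sum>k<n. c k j * s ^ k)" for j s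
  \<comment> \<open>The factor \<open>1\<close> is a trivial column scaling that gives
    \<open>E\<close> the shape of \<open>mdet_scale\<close>.\<close>
  define E where "E \<epsilon> k j = (1 / \<epsilon> ^ k) * 1 * (\<Sum>i<n. W k i * h j (\<epsilon> * \<xi> i))" for \<epsilon> k j
  \<comment> \<open>\<open>W\<close> extracts the coefficient \<open>c k j\<close> exactly. In the
    remainder the power of \<open>\<epsilon>\<close> left over is nonnegative because
    \<open>k \<le> n - 1\<close>.\<close>
  have E: "E \<epsilon> k j = c k j + (\<Sum>i<n. W k i * (R j (\<epsilon> * \<xi> i) / (\<epsilon> * \<xi> i) ^ (n - 1) * \<xi> i ^ (n - 1) * \<epsilon> ^ (n - 1 - k)))"
    if "\<epsilon> > 0" "k < n" "j < n" for \<epsilon> k j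
  proof -
    have "(\<Sum>i<n. W k i * h j (\<epsilon> * \<xi> i)) =
        (\<Sum>i<n. \<Sum>l<n. W k i * (c l j * (\<epsilon> * \<xi> i) ^ l)) + (\<Sum>i<n. W k i * R j (\<epsilon> * \<xi> i))"
      unfolding R_def by (simp add: sum_distrib_left algebra_simps sum_subtractf)
    also have "(\<Sum>i<n. \<Sum>l<n. W k i * (c l j * (\<epsilon> * \<xi> i) ^ l)) =
        (\<Sum>l<n. \<Sum>i<n. W k i * (c l j * (\<epsilon> * \<xi> i) ^ l))"
      by (rule sum.swap)
    also have "\<dots> = (\<Sum>l<n. c l j * \<epsilon> ^ l * (\<Sum>i<n. W k i * \<xi> i ^ l))"
      by (simp add: sum_distrib_left power_mult_distrib mult_ac)
    also have "\<dots> = (\<Sum>l<n. if k = l then c l j * \<epsilon> ^ l else 0)"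
      using W(2)[OF that(2)] by (intro sum.cong refl) simp
    also have "\<dots> = c k j * \<epsilon> ^ k" using that(2) by simp
    finally have "E \<epsilon> k j = c k j + (\<Sum>i<n. W k i * (R j (\<epsilon> * \<xi> i) / \<epsilon> ^ k))"
      using that(1) by (simp add: E_def distrib_left sum_divide_distrib)
    moreover have "R j (\<epsilon> * \<xi> i) / \<epsilon> ^ k =
        R j (\<epsilon> * \<xi> i) / (\<epsilon> * \<xi> i) ^ (n - 1) * \<xi> i ^ (n - 1) * \<epsilon> ^ (n - 1 - k)" if "i < n" for i
    proof -
      have "\<epsilon> ^ (n - 1) = \<epsilon> ^ k * \<epsilon> ^ (n - 1 - k)"
        using \<open>k < n\<close> by (simp flip: power_add)
      then show ?thesis using \<xi>(2)[OF that] \<open>\<epsilon> > 0\<close> by (simp add: power_mult_distrib)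
    qed
    ultimately show ?thesis by simp
  qed
  have "((\<lambda>\<epsilon>. mdet n (E \<epsilon>)) \<longlongrightarrow> mdet n c) (at_right 0)"
  proof (rule tendsto_mdet)
    fix k j assume kj: "k < n" "j < n"
    have "((\<lambda>\<epsilon>. R j (\<epsilon> * \<xi> i) / (\<epsilon> * \<xi> i) ^ (n - 1)) \<longlongrightarrow> 0) (at_right 0)" if "i < n" for i
      using filterlim_compose[OF lim[OF kj(2)] filterlim_mult_pos_at_right_0[OF \<xi>(2)[OF that]]]
      by (simp add: R_def)
    then have "((\<lambda>\<epsilon>. c k j + (\<Sum>i<n. W k i * (R j (\<epsilon> * \<xi> i) / (\<epsilon> * \<xi> i) ^ (n - 1) * \<xi> i ^ (n - 1) * \<epsilon> ^ (n - 1 - k))))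
        \<longlongrightarrow> c k j + (\<Sum>i<n. W k i * (0 * \<xi> i ^ (n - 1) * 0 ^ (n - 1 - k)))) (at_right 0)"
      by (intro tendsto_intros) auto
    moreover have "\<forall>\<^sub>F \<epsilon> in at_right 0. c k j + (\<Sum>i<n. W k i * (R j (\<epsilon> * \<xi> i) / (\<epsilon> * \<xi> i) ^ (n - 1) * \<xi> i ^ (n - 1) * \<epsilon> ^ (n - 1 - k)))
        = E \<epsilon> k j"
      using E[OF _ kj] by (auto intro!: eventually_mono[OF eventually_at_right_less])
    ultimately show "((\<lambda>\<epsilon>. E \<epsilon> k j) \<longlongrightarrow> c k j) (at_right 0)"
      by (simp add: tendsto_cong)
  qed
  moreover have "\<forall>\<^sub>F \<epsilon> in at_right 0. 0 \<le> mdet n (E \<epsilon>)"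
  proof (rule eventually_mono[OF eventually_at_right_less])
    fix \<epsilon> :: real assume \<epsilon>: "0 < \<epsilon>"
    have "mdet n (E \<epsilon>) = (\<Prod>k=0..<n. 1 / \<epsilon> ^ k) * (\<Prod>j=0..<n. 1) *
        mdet n (\<lambda>k j. \<Sum>i<n. W k i * h j (\<epsilon> * \<xi> i))"
      unfolding E_def by (rule mdet_scale)
    also have "\<dots> = (\<Prod>k=0..<n. 1 / \<epsilon> ^ k) * (mdet n W * mdet n (\<lambda>i j. h j (\<epsilon> * \<xi> i)))"
      by (simp only: mdet_mult) simp
    also have "\<dots> \<ge> 0"
      using \<epsilon> W(1) nonneg[OF \<epsilon>] by (intro mult_nonneg_nonneg prod_nonneg) auto
    finally show "0 \<le> mdet n (E \<epsilon>)" .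
  qed
  ultimately show ?thesis by (intro tendsto_lowerbound) auto
qed

text \<open>The one-variable result is applied in \<open>u\<close> with \<open>\<eta>\<close> fixed,
  and then, after transposition, to the coefficient functions \<open>e k\<close> in
  \<open>v\<close>.\<close>

lemma mdet_Peano_coeffs_nonneg2:
  fixes \<xi> \<zeta> :: "nat \<Rightarrow> real" and g :: "real \<Rightarrow> real \<Rightarrow> real"
    and e :: "nat \<Rightarrow> real \<Rightarrow> real" and b :: "nat \<Rightarrow> nat \<Rightarrow> real"
  assumes \<xi>: "strict_mono_on {..<n} \<xi>" "\<And>i. i < n \<Longrightarrow> \<xi> i > 0"
    and \<zeta>: "strict_mono_on {..<n} \<zeta>" "\<And>i. i < n \<Longrightarrow> \<zeta> i > 0"
    and pos: "\<And>\<epsilon> \<eta>. \<epsilon> > 0 \<Longrightarrow> \<eta> > 0 \<Longrightarrow> mdet n (\<lambda>i j. g (\<epsilon> * \<xi> i) (\<eta> * \<zeta> j)) \<ge> 0"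
    and u: "\<And>v. v > 0 \<Longrightarrow>
      ((\<lambda>u. (g u v - (\<Sum>k<n. e k v * u ^ k)) / u ^ (n - 1)) \<longlongrightarrow> 0) (at_right 0)"
    and v: "\<And>k. k < n \<Longrightarrow>
      ((\<lambda>v. (e k v - (\<Sum>l<n. b k l * v ^ l)) / v ^ (n - 1)) \<longlongrightarrow> 0) (at_right 0)"
  shows "mdet n b \<ge> 0"
proof -
  have e: "mdet n (\<lambda>k j. e k (\<eta> * \<zeta> j)) \<ge> 0" if "\<eta> > 0" for \<eta>
    using \<xi>
  proof (rule mdet_Peano_coeffs_nonneg[where h = "\<lambda>j u. g u (\<eta> * \<zeta> j)"])
    show "((\<lambda>s. (g s (\<eta> * \<zeta> j) - (\<Sum>k<n. e k (\<eta> * \<zeta> j) * s ^ k)) / s ^ (n - 1)) \<longlongrightarrow> 0) (at_right 0)"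
      if "j < n" for j
      using \<open>\<eta> > 0\<close> \<zeta>(2)[OF that] by (intro u) simp
  qed (use pos that in auto)
  have e': "mdet n (\<lambda>i k. e k (\<eta> * \<zeta> i)) \<ge> 0" if "\<eta> > 0" for \<eta>
    using e[OF that] mdet_transpose[of n "\<lambda>k i. e k (\<eta> * \<zeta> i)"] by simp
  have "mdet n (\<lambda>l k. b k l) \<ge> 0"
    by (rule mdet_Peano_coeffs_nonneg[OF \<zeta>, where h = e]) (use v e' in auto)
  then show ?thesis using mdet_transpose[of n b] by simp
qed

text \<open>The cubic Taylor polynomial of the power is composed with the inner polynomial. The
  cubic coefficient \<open>y u\<close> may vary, which absorbs all higher powers of
  \<open>u\<close>; \<open>a > 0\<close> makes the inner increment approach 0 from the
  right.\<close>

lemma powr_one_plus_expansion: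
  fixes y :: "real \<Rightarrow> real"
  assumes a: "a > 0" and y: "(y \<longlongrightarrow> c) (at_right 0)"
  shows "((\<lambda>u. ((1 + a * u + b * u\<^sup>2 + y u * u ^ 3) powr \<alpha>
     - (1 + \<alpha> * a * u + (\<alpha> * b + \<alpha> * (\<alpha> - 1) / 2 * a\<^sup>2) * u\<^sup>2
        + (\<alpha> * c + \<alpha> * (\<alpha> - 1) * a * b + \<alpha> * (\<alpha> - 1) * (\<alpha> - 2) / 6 * a ^ 3) * u ^ 3)) / u ^ 3) \<longlongrightarrow> 0) (at_right 0)"
proof -
  define C2 where "C2 = \<alpha> * (\<alpha> - 1) / 2"
  define C3 where "C3 = \<alpha> * (\<alpha> - 1) * (\<alpha> - 2) / 6"
  define T where "T w = 1 + \<alpha> * w + C2 * w\<^sup>2 + C3 * w ^ 3" for w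
  define y1 where "y1 u = b + y u * u" for u
  define y0 where "y0 u = a + y1 u * u" for u
  define z where "z u = y0 u * u" for u
  have y1: "(y1 \<longlongrightarrow> b) (at_right 0)"
    unfolding y1_def by (auto intro!: tendsto_eq_intros y)
  have y0: "(y0 \<longlongrightarrow> a) (at_right 0)"
    unfolding y0_def by (auto intro!: tendsto_eq_intros y1)
  have lim1: "((\<lambda>w. ((1 + w) powr \<alpha> - T w) / w ^ 3) \<longlongrightarrow> 0) (at_right 0)"
    unfolding T_def C2_def C3_def by real_asymp
  have y0pos: "\<forall>\<^sub>F u in at_right 0. 0 < y0 u"
    using order_tendstoD(1)[OF y0 a] .
  then have zpos: "\<forall>\<^sub>F u in at_right 0. 0 < z u"
    using eventually_at_right_less[of 0] by eventually_elim (simp add: z_def)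
  have "(z \<longlongrightarrow> 0) (at_right 0)"
    unfolding z_def by (auto intro!: tendsto_eq_intros y0)
  then have "filterlim z (at_right 0) (at_right 0)"
    unfolding filterlim_at using zpos by (auto elim!: eventually_mono)
  from filterlim_compose[OF lim1 this]
  \<comment> \<open>Since \<open>z u = y0 u * u\<close>, the first summand is the Taylor remainder
    over \<open>u ^ 3\<close>. The second is what remains of \<open>T (z u)\<close> after
    subtracting the claimed cubic polynomial, also over \<open>u ^ 3\<close>.\<close>
  have "((\<lambda>u. ((1 + z u) powr \<alpha> - T (z u)) / z u ^ 3 * y0 u ^ 3
      + (\<alpha> * (y u - c) + C2 * u * (2 * a * y u + (y1 u)\<^sup>2)
         + C3 * u * (3 * a\<^sup>2 * y1 u + 3 * a * u * (y1 u)\<^sup>2 + u\<^sup>2 * y1 u ^ 3)))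
      \<longlongrightarrow> 0 * a ^ 3 + (\<alpha> * (c - c) + C2 * 0 * (2 * a * c + b\<^sup>2)
         + C3 * 0 * (3 * a\<^sup>2 * b + 3 * a * 0 * b\<^sup>2 + 0\<^sup>2 * b ^ 3))) (at_right 0)"
    by (intro tendsto_intros y y0 y1)
  then have lim2: "((\<lambda>u. ((1 + z u) powr \<alpha> - T (z u)) / z u ^ 3 * y0 u ^ 3
      + (\<alpha> * (y u - c) + C2 * u * (2 * a * y u + (y1 u)\<^sup>2)
         + C3 * u * (3 * a\<^sup>2 * y1 u + 3 * a * u * (y1 u)\<^sup>2 + u\<^sup>2 * y1 u ^ 3))) \<longlongrightarrow> 0) (at_right 0)"
    by simp
  have "\<forall>\<^sub>F u in at_right 0. ((1 + z u) powr \<alpha> - T (z u)) / z u ^ 3 * y0 u ^ 3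
      + (\<alpha> * (y u - c) + C2 * u * (2 * a * y u + (y1 u)\<^sup>2)
         + C3 * u * (3 * a\<^sup>2 * y1 u + 3 * a * u * (y1 u)\<^sup>2 + u\<^sup>2 * y1 u ^ 3))
     = ((1 + a * u + b * u\<^sup>2 + y u * u ^ 3) powr \<alpha>
       - (1 + \<alpha> * a * u + (\<alpha> * b + C2 * a\<^sup>2) * u\<^sup>2 + (\<alpha> * c + 2 * C2 * a * b + C3 * a ^ 3) * u ^ 3)) / u ^ 3"
    using y0pos eventually_at_right_less[of 0]
  proof eventually_elim
    fix u assume u: "0 < y0 u" "(0::real) < u"
    define P where "P = (1 + z u) powr \<alpha>"
    have z: "1 + a * u + b * u\<^sup>2 + y u * u ^ 3 = 1 + z u"
      by (simp add: z_def y0_def y1_def algebra_simps power2_eq_square power3_eq_cube)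
    have "(P - T (z u)) / z u ^ 3 * y0 u ^ 3 = (P - T (z u)) / u ^ 3"
      using u by (simp add: z_def power_mult_distrib)
    moreover have "T (z u) - (1 + \<alpha> * a * u + (\<alpha> * b + C2 * a\<^sup>2) * u\<^sup>2 + (\<alpha> * c + 2 * C2 * a * b + C3 * a ^ 3) * u ^ 3)
       = u ^ 3 * (\<alpha> * (y u - c) + C2 * u * (2 * a * y u + (y1 u)\<^sup>2)
         + C3 * u * (3 * a\<^sup>2 * y1 u + 3 * a * u * (y1 u)\<^sup>2 + u\<^sup>2 * y1 u ^ 3))"
    proof -
      have z1: "z u = a * u + b * u\<^sup>2 + y u * u ^ 3"
        by (simp add: z_def y0_def y1_def power2_eq_square power3_eq_cube algebra_simps)
      have z2: "(z u)\<^sup>2 = a\<^sup>2 * u\<^sup>2 + 2 * a * b * u ^ 3 + u ^ 3 * (u * (2 * a * y u + (y1 u)\<^sup>2))"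
        by (simp add: z_def y0_def y1_def power2_eq_square power3_eq_cube algebra_simps)
      have z3: "z u ^ 3 = a ^ 3 * u ^ 3 + u ^ 3 * (u * (3 * a\<^sup>2 * y1 u + 3 * a * u * (y1 u)\<^sup>2 + u\<^sup>2 * y1 u ^ 3))"
        by (simp add: z_def y0_def power2_eq_square power3_eq_cube algebra_simps)
      show ?thesis
        unfolding T_def z2 z3 unfolding z1 by (simp add: algebra_simps)
    qed
    then have "\<alpha> * (y u - c) + C2 * u * (2 * a * y u + (y1 u)\<^sup>2)
         + C3 * u * (3 * a\<^sup>2 * y1 u + 3 * a * u * (y1 u)\<^sup>2 + u\<^sup>2 * y1 u ^ 3)
       = (T (z u) - (1 + \<alpha> * a * u + (\<alpha> * b + C2 * a\<^sup>2) * u\<^sup>2 + (\<alpha> * c + 2 * C2 * a * b + C3 * a ^ 3) * u ^ 3)) / u ^ 3"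
      using u by simp
    ultimately show "((1 + z u) powr \<alpha> - T (z u)) / z u ^ 3 * y0 u ^ 3
      + (\<alpha> * (y u - c) + C2 * u * (2 * a * y u + (y1 u)\<^sup>2)
         + C3 * u * (3 * a\<^sup>2 * y1 u + 3 * a * u * (y1 u)\<^sup>2 + u\<^sup>2 * y1 u ^ 3))
     = ((1 + a * u + b * u\<^sup>2 + y u * u ^ 3) powr \<alpha>
       - (1 + \<alpha> * a * u + (\<alpha> * b + C2 * a\<^sup>2) * u\<^sup>2 + (\<alpha> * c + 2 * C2 * a * b + C3 * a ^ 3) * u ^ 3)) / u ^ 3"
      unfolding z P_def[symmetric] by (simp add: diff_divide_distrib)
  qed
  note lim3 = Lim_transform_eventually[OF lim2 this]
  have C2': "2 * C2 = \<alpha> * (\<alpha> - 1)" by (simp add: C2_def)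
  from lim3[unfolded C2', unfolded C2_def C3_def] show ?thesis .
qed

section \<open>Restrictions on the exponent\<close>

lemma TP_preservers_powr:
  assumes F: "F \<in> TP_preservers p X Y" and p: "1 \<le> p"
    and c: "0 < c" "\<And>x. 0 < x \<Longrightarrow> F x = c * x powr \<alpha>" and K: "TP_kernel p X Y K"
  shows "TP_kernel p X Y (\<lambda>z. K z powr \<alpha>)"
proof -
  have "TP_kernel p X Y (\<lambda>(x, y). 1 / c * 1 * (F \<circ> K) (x, y))"
    using c(1) by (intro TP_kernel_scale TP_preserversD[OF F K]) auto
  moreover have "1 / c * 1 * (F \<circ> K) (x, y) = K (x, y) powr \<alpha>" if "x \<in> X" "y \<in> Y" for x y
    using TP_kernel_pos[OF K p that] c by simp
  ultimately show ?thesis by (subst (asm) TP_kernel_cong) auto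
qed

text \<open>Rescaling \<open>U\<close> and \<open>V\<close> by positive factors keeps them
  admissible, which is why \<open>K\<close> ranges over all of them. Strict positivity of the minors
  survives only as \<open>\<ge>\<close> in the limit.\<close>

lemma TP_preservers_powr_coeffs:
  fixes X :: "'a::linorder set" and Y :: "'b::linorder set" and k :: "real \<Rightarrow> real \<Rightarrow> real"
  assumes F: "F \<in> TP_preservers p X Y"
    and X: "infinite X \<or> p \<le> card X" and Y: "infinite Y \<or> p \<le> card Y"
    and c: "0 < c" "\<And>x. 0 < x \<Longrightarrow> F x = c * x powr \<alpha>"
    and n: "1 \<le> n" "n \<le> p"
    and U: "strict_mono_on X U" "\<And>x. x \<in> X \<Longrightarrow> (0::real) < U x"
    and V: "strict_mono_on Y V" "\<And>x. x \<in> Y \<Longrightarrow> (0::real) < V x"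
    and K: "\<And>U V. strict_mono_on X U \<Longrightarrow> (\<And>x. x \<in> X \<Longrightarrow> (0::real) < U x) \<Longrightarrow>
      strict_mono_on Y V \<Longrightarrow> (\<And>x. x \<in> Y \<Longrightarrow> (0::real) < V x) \<Longrightarrow> TP_kernel p X Y (\<lambda>(x, y). k (U x) (V y))"
    and u: "\<And>v. v > 0 \<Longrightarrow>
      ((\<lambda>u. (k u v powr \<alpha> - (\<Sum>i<n. e i v * u ^ i)) / u ^ (n - 1)) \<longlongrightarrow> 0) (at_right 0)"
    and v: "\<And>i. i < n \<Longrightarrow>
      ((\<lambda>v. (e i v - (\<Sum>l<n. b i l * v ^ l)) / v ^ (n - 1)) \<longlongrightarrow> 0) (at_right 0)"
  shows "mdet n b \<ge> 0"
proof -
  obtain x where x: "x \<in> {..<n} \<rightarrow> X" "strict_mono_on {..<n} x"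
    using ex_strict_mono_nodes[of X n] n(2) X by (metis order_trans)
  obtain y where y: "y \<in> {..<n} \<rightarrow> Y" "strict_mono_on {..<n} y"
    using ex_strict_mono_nodes[of Y n] n(2) Y by (metis order_trans)
  show ?thesis
  proof (rule mdet_Peano_coeffs_nonneg2[OF _ _ _ _ _ u v])
    show "strict_mono_on {..<n} (\<lambda>i. U (x i))" "strict_mono_on {..<n} (\<lambda>j. V (y j))"
      using x y U(1) V(1) by (auto simp: strict_mono_on_def Pi_iff)
    show "U (x i) > 0" "V (y i) > 0" if "i < n" for i
      using that x(1) y(1) U(2) V(2) by auto
    fix \<epsilon> \<eta> :: real assume "\<epsilon> > 0" "\<eta> > 0"
    then have "TP_kernel p X Y (\<lambda>(x, y). k (\<epsilon> * U x) (\<eta> * V y))"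
      using U V by (intro K) (auto simp: strict_mono_on_def)
    then have "TP_kernel p X Y (\<lambda>z. (case z of (x, y) \<Rightarrow> k (\<epsilon> * U x) (\<eta> * V y)) powr \<alpha>)"
      using n by (intro TP_preservers_powr[OF F _ c]) auto
    from TP_kernelD[OF this n x y]
    show "mdet n (\<lambda>i j. k (\<epsilon> * U (x i)) (\<eta> * V (y j)) powr \<alpha>) \<ge> 0" by simp
  qed
qed

lemma sum_lessThan_3_plus:
  fixes f :: "nat \<Rightarrow> real"
  assumes "3 \<le> p"
  shows "(\<Sum>k<p. f k) = f 0 + f 1 + f 2 + (\<Sum>k<p - 3. f (k + 3))"
proof -
  have "(\<Sum>k<r + 3. f k) = f 0 + f 1 + f 2 + (\<Sum>k<r. f (k + 3))" for r
    by (induction r) (simp_all add: eval_nat_numeral)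
  from this[of "p - 3"] show ?thesis using assms by simp
qed

text \<open>The kernel is a composition of two power kernels, with the weights \<open>d k\<close>
  absorbed as column factors of the first.\<close>

lemma TP_kernel_power_sum:
  fixes X :: "'a::linorder set" and Y :: "'b::linorder set"
  assumes U: "strict_mono_on X U" "\<And>x. x \<in> X \<Longrightarrow> (0::real) < U x"
    and V: "strict_mono_on Y V" "\<And>y. y \<in> Y \<Longrightarrow> (0::real) < V y"
    and d: "\<And>k. 0 < d k"
  shows "TP_kernel p X Y (\<lambda>(x, y). \<Sum>k<p. d k * U x ^ k * V y ^ k)"
proof -
  have A: "TP_kernel p X {..<p} (\<lambda>(x, k). 1 * d k * (case (x, k) of (x, k) \<Rightarrow> U x ^ k))"
    using d by (intro TP_kernel_scale TP_kernel_power[OF U]) auto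
  have B: "TP_kernel p {..<p} Y (\<lambda>(k, y). case (y, k) of (y, k) \<Rightarrow> V y ^ k)"
    by (rule TP_kernel_swap[OF TP_kernel_power[OF V]])
  show ?thesis using TP_kernel_compose[OF A B] by simp
qed

text \<open>For the kernel with weights \<open>1, 1, \<delta>, \<delta>, ...\<close> the coefficient
  matrix of the power is diagonal with entries \<open>1\<close>, \<open>\<alpha>\<close>,
  \<open>B\<close>.\<close>

lemma TP_preservers_exponent_ge_1:
  fixes X :: "'a::linorder set" and Y :: "'b::linorder set"
  assumes F: "F \<in> TP_preservers p X Y" and p: "3 \<le> p"
    and X: "infinite X \<or> p \<le> card X" and Y: "infinite Y \<or> p \<le> card Y"
    and c: "0 < c" "\<And>x. 0 < x \<Longrightarrow> F x = c * x powr \<alpha>" and \<alpha>: "0 < \<alpha>"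
    and U: "strict_mono_on X U" "\<And>x. x \<in> X \<Longrightarrow> (0::real) < U x"
    and V: "strict_mono_on Y V" "\<And>y. y \<in> Y \<Longrightarrow> (0::real) < V y"
  shows "1 \<le> \<alpha>"
proof (rule ccontr)
  assume "\<not> 1 \<le> \<alpha>"
  \<comment> \<open>This choice gives \<open>B = \<alpha> * (\<alpha> - 1) / 4\<close>, which is
    negative for \<open>\<alpha> < 1\<close>.\<close>
  define \<delta> where "\<delta> = (1 - \<alpha>) / 4"
  have \<delta>: "\<delta> > 0" using \<open>\<not> 1 \<le> \<alpha>\<close> by (simp add: \<delta>_def)
  define d where "d k = (if k < 2 then 1 else \<delta>)" for k :: nat
  define w where "w v u = (\<Sum>k<p - 3. \<delta> * u ^ k * v ^ (k + 3))" for u v :: real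
  define e3 where "e3 v = \<alpha> * w v 0 + \<alpha> * (\<alpha> - 1) * v * (\<delta> * v\<^sup>2) + \<alpha> * (\<alpha> - 1) * (\<alpha> - 2) / 6 * v ^ 3" for v
  define B where "B = \<alpha> * \<delta> + \<alpha> * (\<alpha> - 1) / 2"
  define e where "e i v = (if i = 0 then 1 else if i = 1 then \<alpha> * v else B * v\<^sup>2)" for i :: nat and v :: real
  define b where "b i l = (if i = l then if i = 0 then 1 else if i = 1 then \<alpha> else B else 0)" for i l :: nat
  have "mdet 3 b \<ge> 0"
  proof (rule TP_preservers_powr_coeffs[OF F X Y c _ p U V, where e = e])
    show "TP_kernel p X Y (\<lambda>(x, y). \<Sum>k<p. d k * U x ^ k * V y ^ k)"
      if "strict_mono_on X U" "\<And>x. x \<in> X \<Longrightarrow> (0::real) < U x"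
        "strict_mono_on Y V" "\<And>y. y \<in> Y \<Longrightarrow> (0::real) < V y" for U V
      by (rule TP_kernel_power_sum[OF that]) (auto simp: d_def \<delta>)
    fix v :: real assume v: "0 < v"
    let ?k = "\<lambda>u v. \<Sum>k<p. d k * u ^ k * v ^ k"
    have k: "?k u v = 1 + v * u + \<delta> * v\<^sup>2 * u\<^sup>2 + w v u * u ^ 3" for u
      unfolding sum_lessThan_3_plus[OF p] w_def sum_distrib_right
      by (simp add: d_def power_add mult_ac)
    have "((\<lambda>u. w v u) \<longlongrightarrow> w v 0) (at_right 0)"
      unfolding w_def by (intro tendsto_intros)
    moreover have e: "(\<Sum>i<3. e i v * u ^ i) + e3 v * u ^ 3 =
        1 + \<alpha> * v * u + (\<alpha> * (\<delta> * v\<^sup>2) + \<alpha> * (\<alpha> - 1) / 2 * v\<^sup>2) * u\<^sup>2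
        + (\<alpha> * w v 0 + \<alpha> * (\<alpha> - 1) * v * (\<delta> * v\<^sup>2) + \<alpha> * (\<alpha> - 1) * (\<alpha> - 2) / 6 * v ^ 3) * u ^ 3" for u
      by (simp add: e_def e3_def B_def eval_nat_numeral algebra_simps)
    ultimately have "((\<lambda>u. (?k u v powr \<alpha> - ((\<Sum>i<3. e i v * u ^ i) + e3 v * u ^ 3)) / u ^ 3) \<longlongrightarrow> 0) (at_right 0)"
      using powr_one_plus_expansion[OF v, of "w v" "w v 0" "\<delta> * v\<^sup>2" \<alpha>] by (simp only: k)
    \<comment> \<open>Order three needs an error of smaller order than \<open>u\<^sup>2\<close>
      only, so the cubic term \<open>e3 v\<close> is moved into the remainder.\<close>
    then have "((\<lambda>u. (?k u v powr \<alpha> - ((\<Sum>i<3. e i v * u ^ i) + e3 v * u ^ 3)) / u ^ 3 * u + e3 v * u) \<longlongrightarrow> 0 * 0 + e3 v * 0) (at_right 0)"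
      by (intro tendsto_intros)
    moreover have "\<forall>\<^sub>F u in at_right 0. (?k u v powr \<alpha> - ((\<Sum>i<3. e i v * u ^ i) + e3 v * u ^ 3)) / u ^ 3 * u + e3 v * u
        = (?k u v powr \<alpha> - (\<Sum>i<3. e i v * u ^ i)) / u ^ (3 - 1)"
      by (rule eventually_mono[OF eventually_at_right_less]) (simp add: field_simps eval_nat_numeral)
    ultimately show "((\<lambda>u. (?k u v powr \<alpha> - (\<Sum>i<3. e i v * u ^ i)) / u ^ (3 - 1)) \<longlongrightarrow> 0) (at_right 0)"
      by (auto intro: Lim_transform_eventually)
  next
    fix i :: nat assume "i < 3"
    then consider "i = 0" | "i = 1" | "i = 2" by linarith
    then have "e i v = (\<Sum>l<3. b i l * v ^ l)" for v
      by cases (simp_all add: e_def b_def eval_nat_numeral)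
    then show "((\<lambda>v. (e i v - (\<Sum>l<3. b i l * v ^ l)) / v ^ (3 - 1)) \<longlongrightarrow> 0) (at_right 0)"
      by simp
  qed simp_all
  moreover have "mdet 3 b = \<alpha> * B" by (simp add: mdet_3 b_def)
  moreover have "B = \<alpha> * ((\<alpha> - 1) / 4)" by (simp add: B_def \<delta>_def field_simps)
  ultimately have "0 \<le> \<alpha> * (\<alpha> * ((\<alpha> - 1) / 4))" by simp
  then show False using \<alpha> \<open>\<not> 1 \<le> \<alpha>\<close> by (simp add: zero_le_mult_iff)
qed

lemma mdet_4_block:
  assumes "f 0 0 = 1" "f 0 1 = 0" "f 0 2 = 0" "f 0 3 = 0" "f 1 0 = 0" "f 1 2 = 0" "f 1 3 = 0"
  shows "mdet 4 f = f 1 1 * (f 2 2 * f 3 3 - f 2 3 * f 3 2)"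
  using assms by (simp add: mdet_expand_last_row eval_nat_numeral algebra_simps)

text \<open>The determinant of the coefficients is affine in the parameter \<open>t\<close>, with
  slope \<open>- 2 * \<alpha>\<^sup>2 * C2\<close>, negative for
  \<open>\<alpha> > 1\<close>.\<close>

lemma TP_preservers_exponent_le_1:
  fixes X :: "'a::linorder set" and Y :: "'b::linorder set"
  assumes F: "F \<in> TP_preservers p X Y" and p: "4 \<le> p"
    and X: "infinite X \<or> p \<le> card X" and Y: "infinite Y \<or> p \<le> card Y"
    and c: "0 < c" "\<And>x. 0 < x \<Longrightarrow> F x = c * x powr \<alpha>" and \<alpha>: "0 < \<alpha>"
    and U: "strict_mono_on X U" "\<And>x. x \<in> X \<Longrightarrow> (0::real) < U x"
    and V: "strict_mono_on Y V" "\<And>y. y \<in> Y \<Longrightarrow> (0::real) < V y"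
  shows "\<alpha> \<le> 1"
proof (rule ccontr)
  assume "\<not> \<alpha> \<le> 1"
  then have \<alpha>1: "\<alpha> > 1" by simp
  define C2 where "C2 = \<alpha> * (\<alpha> - 1) / 2"
  define C3 where "C3 = \<alpha> * (\<alpha> - 1) * (\<alpha> - 2) / 6"
  have C2: "C2 > 0" using \<alpha>1 by (simp add: C2_def)
  \<comment> \<open>\<open>M\<close> is the part free of \<open>t\<close>, the product of the last
    two diagonal entries of \<open>b\<close>; \<open>t\<close> is then taken large enough to
    outweigh it.\<close>
  define M where "M = (\<alpha> + C2) * (\<alpha> + 2 * C2 + C3)"
  define t where "t = (\<bar>M\<bar> + 1) / (2 * \<alpha> * C2)"
  have t: "t > 0" "2 * \<alpha> * C2 * t = \<bar>M\<bar> + 1" using C2 \<alpha> by (simp_all add: t_def)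
  define w where "w v u = (\<Sum>k<p - 3. u ^ k * v ^ (k + 3))" for u v :: real
  define a2 where "a2 v = v + v\<^sup>2 + t * v ^ 3" for v :: real
  \<comment> \<open>These are the coefficients given by \<open>powr_one_plus_expansion\<close> for
    linear, quadratic and cubic terms \<open>v\<close>, \<open>a2 v\<close> and
    \<open>v ^ 3\<close>; \<open>b\<close> truncates them after \<open>v ^ 3\<close>.\<close>
  define e where "e i v = (if i = 0 then 1 else if i = 1 then \<alpha> * v else if i = 2 then \<alpha> * a2 v + C2 * v\<^sup>2
      else \<alpha> * v ^ 3 + 2 * C2 * v * a2 v + C3 * v ^ 3)" for i :: nat and v :: real
  define b where "b i l = (if i = 0 then if l = 0 then 1 else 0
      else if i = 1 then if l = 1 then \<alpha> else 0
      else if i = 2 then if l = 1 then \<alpha> else if l = 2 then \<alpha> + C2 else if l = 3 then \<alpha> * t else 0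
      else if l = 2 then 2 * C2 else if l = 3 then \<alpha> + 2 * C2 + C3 else 0)" for i l :: nat
  \<comment> \<open>Both factors are power kernels altered by one row operation: index 2 is added to
    index 1 in \<open>\<Phi>\<close>, and \<open>t\<close> times index 3 to index 2 in
    \<open>\<Psi>\<close>.\<close>
  define \<Phi> where "\<Phi> u k = u ^ k + (if k = 1 then u\<^sup>2 else 0)" for u :: real and k :: nat
  define \<Psi> where "\<Psi> v k = v ^ k + (if k = 2 then t * v ^ 3 else 0)" for v :: real and k :: nat
  have "mdet 4 b \<ge> 0"
  proof (rule TP_preservers_powr_coeffs[OF F X Y c _ p U V, where e = e])
    show "TP_kernel p X Y (\<lambda>(x, y). \<Sum>k<p. \<Phi> (U x) k * \<Psi> (V y) k)"
      if U: "strict_mono_on X U" "\<And>x. x \<in> X \<Longrightarrow> (0::real) < U x"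
        and V: "strict_mono_on Y V" "\<And>y. y \<in> Y \<Longrightarrow> (0::real) < V y" for U V
    proof -
      have "TP_kernel p {..<p} X (\<lambda>(k, x). (case (k, x) of (k, x) \<Rightarrow> case (x, k) of (x, k) \<Rightarrow> U x ^ k)
          + (if k = 1 then 1 * (case (Suc k, x) of (k, x) \<Rightarrow> case (x, k) of (x, k) \<Rightarrow> U x ^ k) else 0))"
        using p by (intro TP_kernel_add_row TP_kernel_swap[OF TP_kernel_power[OF U]]) auto
      from TP_kernel_swap[OF this]
      have A: "TP_kernel p X {..<p} (\<lambda>(x, k). \<Phi> (U x) k)"
        by (subst (asm) TP_kernel_cong) (auto simp: \<Phi>_def eval_nat_numeral)
      have "TP_kernel p {..<p} Y (\<lambda>(k, y). (case (k, y) of (k, y) \<Rightarrow> case (y, k) of (y, k) \<Rightarrow> V y ^ k)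
          + (if k = 2 then t * (case (Suc k, y) of (k, y) \<Rightarrow> case (y, k) of (y, k) \<Rightarrow> V y ^ k) else 0))"
        using p t by (intro TP_kernel_add_row TP_kernel_swap[OF TP_kernel_power[OF V]]) auto
      then have B: "TP_kernel p {..<p} Y (\<lambda>(k, y). \<Psi> (V y) k)"
        by (subst (asm) TP_kernel_cong) (auto simp: \<Psi>_def eval_nat_numeral)
      show ?thesis using TP_kernel_compose[OF A B] by simp
    qed
    fix v :: real assume v: "0 < v"
    let ?k = "\<lambda>u v. \<Sum>k<p. \<Phi> u k * \<Psi> v k"
    have k: "?k u v = 1 + v * u + a2 v * u\<^sup>2 + w v u * u ^ 3" for u
    proof -
      have "3 \<le> p" using p by simp
      from sum_lessThan_3_plus[OF this, of "\<lambda>k. \<Phi> u k * \<Psi> v k"]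
      have "?k u v = 1 + (u + u\<^sup>2) * v + u\<^sup>2 * (v\<^sup>2 + t * v ^ 3)
          + (\<Sum>k<p - 3. u ^ (k + 3) * v ^ (k + 3))"
        by (simp add: \<Phi>_def \<Psi>_def)
      also have "(\<Sum>k<p - 3. u ^ (k + 3) * v ^ (k + 3)) = w v u * u ^ 3"
        unfolding w_def sum_distrib_right by (intro sum.cong refl) (simp add: power_add)
      finally show ?thesis by (simp add: a2_def algebra_simps)
    qed
    \<comment> \<open>Only the term \<open>k = 0\<close> survives, as \<open>0 ^ 0 = 1\<close>; it
      is present because \<open>p \<ge> 4\<close>.\<close>
    have w0: "w v 0 = v ^ 3"
    proof -
      obtain q where "p - 3 = Suc q" using p by (cases "p - 3") auto
      moreover have "(\<Sum>k<Suc q. 0 ^ k * v ^ (k + 3)) = v ^ 3"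
        by (subst sum.lessThan_Suc_shift) simp
      ultimately show ?thesis by (simp only: w_def)
    qed
    have "((\<lambda>u. w v u) \<longlongrightarrow> w v 0) (at_right 0)"
      unfolding w_def by (intro tendsto_intros)
    moreover have "(\<Sum>i<4. e i v * u ^ i) =
        1 + \<alpha> * v * u + (\<alpha> * a2 v + \<alpha> * (\<alpha> - 1) / 2 * v\<^sup>2) * u\<^sup>2
        + (\<alpha> * w v 0 + \<alpha> * (\<alpha> - 1) * v * a2 v + \<alpha> * (\<alpha> - 1) * (\<alpha> - 2) / 6 * v ^ 3) * u ^ 3" for u
    proof -
      have "2 * C2 = \<alpha> * (\<alpha> - 1)" by (simp add: C2_def)
      then have "e 3 v = \<alpha> * w v 0 + \<alpha> * (\<alpha> - 1) * v * a2 v + \<alpha> * (\<alpha> - 1) * (\<alpha> - 2) / 6 * v ^ 3"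
        by (simp add: e_def w0 C3_def)
      moreover have "(\<Sum>i<4. e i v * u ^ i) = e 0 v + e 1 v * u + e 2 v * u\<^sup>2 + e 3 v * u ^ 3"
        by (simp add: eval_nat_numeral)
      ultimately show ?thesis by (simp add: e_def C2_def)
    qed
    moreover have "(4::nat) - 1 = 3" by simp
    ultimately show "((\<lambda>u. (?k u v powr \<alpha> - (\<Sum>i<4. e i v * u ^ i)) / u ^ (4 - 1)) \<longlongrightarrow> 0) (at_right 0)"
      using powr_one_plus_expansion[OF v, of "w v" "w v 0" "a2 v" \<alpha>] by (simp only: k)
  next
    fix i :: nat assume "i < 4"
    then consider "i < 3" | "i = 3" by linarith
    then show "((\<lambda>v. (e i v - (\<Sum>l<4. b i l * v ^ l)) / v ^ (4 - 1)) \<longlongrightarrow> 0) (at_right 0)"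
    proof cases
      case 1
      then consider "i = 0" | "i = 1" | "i = 2" by linarith
      then have "e i v = (\<Sum>l<4. b i l * v ^ l)" for v
        by cases (simp_all add: e_def b_def a2_def eval_nat_numeral algebra_simps)
      then show ?thesis by simp
    next
      case 2
      \<comment> \<open>The truncation drops only the term \<open>2 * C2 * t * v ^ 4\<close> of
        \<open>e 3\<close>.\<close>
      have "((\<lambda>v::real. 2 * C2 * t * v) \<longlongrightarrow> 2 * C2 * t * 0) (at_right 0)"
        by (intro tendsto_intros)
      moreover have "\<forall>\<^sub>F v in at_right 0. 2 * C2 * t * v = (e i v - (\<Sum>l<4. b i l * v ^ l)) / v ^ (4 - 1)"
        by (rule eventually_mono[OF eventually_at_right_less])
           (simp add: 2 e_def b_def a2_def eval_nat_numeral field_simps)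
      ultimately show ?thesis by (auto intro: Lim_transform_eventually)
    qed
  qed simp_all
  moreover have "mdet 4 b = \<alpha> * (M - 2 * \<alpha> * C2 * t)"
    by (subst mdet_4_block) (simp_all add: b_def M_def algebra_simps)
  moreover have "\<dots> < 0" unfolding t using \<alpha> by (intro mult_pos_neg) auto
  ultimately show False by simp
qed

section \<open>Classification of the preservers\<close>

theorem theorem6p7:
  fixes p :: nat and X :: "'a::linorder set" and Y :: "'b::linorder set"
  assumes "p \<ge> 2"
    and "infinite X \<or> card X \<ge> p"
    and "infinite Y \<or> card Y \<ge> p"
    and "\<exists>K. TP_kernel p X Y K"
  shows "(p = 2 \<longrightarrow> TP_preservers p X Y =
            {\<lambda>x\<in>{0<..}. c * x powr \<alpha> | c \<alpha>. c > 0 \<and> \<alpha> > 0})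
       \<and> (p = 3 \<longrightarrow> TP_preservers p X Y =
            {\<lambda>x\<in>{0<..}. c * x powr \<alpha> | c \<alpha>. c > 0 \<and> \<alpha> \<ge> 1})
       \<and> (p \<ge> 4 \<longrightarrow> TP_preservers p X Y =
            {\<lambda>x\<in>{0<..}. c * x | c. c > 0})"
proof -
  obtain K\<^sub>0 where K\<^sub>0: "TP_kernel p X Y K\<^sub>0" using assms(4) by blast
  obtain U :: "'a \<Rightarrow> real" where U: "strict_mono_on X U" "\<And>x. x \<in> X \<Longrightarrow> U x > 0"
    using TP_kernel_embedding[OF K\<^sub>0 assms(1,3)] by blast
  obtain V :: "'b \<Rightarrow> real" where V: "strict_mono_on Y V" "\<And>y. y \<in> Y \<Longrightarrow> V y > 0"
    using TP_kernel_embedding[OF TP_kernel_swap[OF K\<^sub>0] assms(1,2)] by blast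
  \<comment> \<open>All necessary conditions at once; the three cases differ only in which bounds on
    \<open>\<alpha>\<close> become active.\<close>
  have power: "\<exists>c \<alpha>. 0 < c \<and> 0 < \<alpha> \<and> F = (\<lambda>x\<in>{0<..}. c * x powr \<alpha>)
      \<and> (3 \<le> p \<longrightarrow> 1 \<le> \<alpha>) \<and> (4 \<le> p \<longrightarrow> \<alpha> \<le> 1)"
    if F: "F \<in> TP_preservers p X Y" for F
  proof -
    note two = TP_preservers_2x2[OF F assms(1-3) U(1) V(1)]
    have pos: "0 < F a" if "0 < a" for a :: real
      \<comment> \<open>The entries \<open>a, a, a, 2 * a\<close> have a positive minor for every
        \<open>a > 0\<close>.\<close>
      using two(1)[of a a a "2 * a"] that by simp
    obtain c \<alpha> where c: "0 < c" "0 < \<alpha>" "\<And>x. 0 < x \<Longrightarrow> F x = c * x powr \<alpha>"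
      using product_order_preserving_power[of F, OF pos two(2)] by blast
    have "F = (\<lambda>x\<in>{0<..}. c * x powr \<alpha>)"
      using F c(3) by (intro extensionalityI[of _ "{0<..}"]) (auto simp: TP_preservers_def PiE_def)
    moreover have "3 \<le> p \<longrightarrow> 1 \<le> \<alpha>"
      using TP_preservers_exponent_ge_1[OF F _ assms(2,3) c(1,3,2) U V] by blast
    moreover have "4 \<le> p \<longrightarrow> \<alpha> \<le> 1"
      using TP_preservers_exponent_le_1[OF F _ assms(2,3) c(1,3,2) U V] by blast
    ultimately show ?thesis using c by blast
  qed
  \<comment> \<open>The constant \<open>c\<close> is a row factor, so sufficiency reduces to closure
    of the kernels under the entrywise power.\<close>
  have preserver: "(\<lambda>x\<in>{0<..}. c * x powr \<alpha>) \<in> TP_preservers p X Y"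
    if c: "0 < c" and powr: "\<And>K. TP_kernel p X Y K \<Longrightarrow> TP_kernel p X Y (\<lambda>z. K z powr \<alpha>)" for c \<alpha>
  proof -
    have "TP_kernel p X Y ((\<lambda>x\<in>{0<..}. c * x powr \<alpha>) \<circ> K)" if K: "TP_kernel p X Y K" for K
    proof -
      have "TP_kernel p X Y (\<lambda>(x, y). c * 1 * K (x, y) powr \<alpha>)"
        using c powr[OF K] by (intro TP_kernel_scale) auto
      moreover have "c * 1 * K (x, y) powr \<alpha> = ((\<lambda>x\<in>{0<..}. c * x powr \<alpha>) \<circ> K) (x, y)"
        if "x \<in> X" "y \<in> Y" for x y
        using TP_kernel_pos[OF K _ that] assms(1) by simp
      ultimately show ?thesis by (subst (asm) TP_kernel_cong) auto
    qed
    then show ?thesis by (auto simp: TP_preservers_def)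
  qed
  have linear: "(\<lambda>x\<in>{0<..}. c * x powr 1) = (\<lambda>x\<in>{0<..}. c * x)" for c :: real
    by (intro restrict_ext) simp
  have "TP_preservers p X Y = {\<lambda>x\<in>{0<..}. c * x powr \<alpha> | c \<alpha>. c > 0 \<and> \<alpha> > 0}" if "p = 2"
  proof (intro equalityI subsetI)
    show "F \<in> TP_preservers p X Y" if "F \<in> {\<lambda>x\<in>{0<..}. c * x powr \<alpha> | c \<alpha>. c > 0 \<and> \<alpha> > 0}" for F
    proof -
      from that obtain c \<alpha> where F: "0 < c" "0 < \<alpha>" "F = (\<lambda>x\<in>{0<..}. c * x powr \<alpha>)" by blast
      show ?thesis
        unfolding F(3) using TP_kernel_powr_2 \<open>p = 2\<close> F(2) by (intro preserver F(1)) blast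
    qed
  qed (use power in blast)
  moreover have "TP_preservers p X Y = {\<lambda>x\<in>{0<..}. c * x powr \<alpha> | c \<alpha>. c > 0 \<and> \<alpha> \<ge> 1}" if "p = 3"
  proof (intro equalityI subsetI)
    show "F \<in> TP_preservers p X Y" if "F \<in> {\<lambda>x\<in>{0<..}. c * x powr \<alpha> | c \<alpha>. c > 0 \<and> \<alpha> \<ge> 1}" for F
    proof -
      from that obtain c \<alpha> where F: "0 < c" "1 \<le> \<alpha>" "F = (\<lambda>x\<in>{0<..}. c * x powr \<alpha>)" by blast
      show ?thesis
        unfolding F(3) using TP_kernel_powr_3 \<open>p = 3\<close> F(2) by (intro preserver F(1)) blast
    qed
    show "F \<in> {\<lambda>x\<in>{0<..}. c * x powr \<alpha> | c \<alpha>. c > 0 \<and> \<alpha> \<ge> 1}" if "F \<in> TP_preservers p X Y" for F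
      using power[OF that] \<open>p = 3\<close> by auto
  qed
  moreover have "TP_preservers p X Y = {\<lambda>x\<in>{0<..}. c * x | c. c > 0}" if "4 \<le> p"
  proof (intro equalityI subsetI)
    fix F :: "real \<Rightarrow> real" assume "F \<in> {\<lambda>x\<in>{0<..}. c * x | c. c > 0}"
    then obtain c where c: "0 < c" "F = (\<lambda>x\<in>{0<..}. c * x)" by blast
    have "TP_kernel p X Y (\<lambda>z. K z powr 1)" if K: "TP_kernel p X Y K" for K
    proof -
      have "K (x, y) = K (x, y) powr 1" if "x \<in> X" "y \<in> Y" for x y
        using TP_kernel_pos[OF K _ that] assms(1) by simp
      from TP_kernel_cong[of X Y K "\<lambda>z. K z powr 1", OF this] K show ?thesis by blast
    qed
    then show "F \<in> TP_preservers p X Y"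
      unfolding c(2) linear[symmetric] by (intro preserver[OF c(1)])
  next
    fix F assume "F \<in> TP_preservers p X Y"
    from power[OF this] that obtain c \<alpha> where c: "0 < c" "F = (\<lambda>x\<in>{0<..}. c * x powr \<alpha>)" "\<alpha> = 1"
      by force
    have "F = (\<lambda>x\<in>{0<..}. c * x)" by (simp only: c(2,3) linear)
    then show "F \<in> {\<lambda>x\<in>{0<..}. c * x | c. c > 0}" using c(1) by blast
  qed
  ultimately show ?thesis by blast
qed

end
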